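(* Let $G=\mathbb Z_m*\mathbb Z_n$ with $m\ge2$ and $n\ge3$, with generators $s$ of order $m$ and $t$ of order $n$. Then the first higher Kazhdan projection $p_1$ (associated with the presentation complex of $\langle s,t\mid s^m,t^n\rangle$ and the left regular representation) lies in $\mathrm M_2(\mathrm C^*_{\mathrm{red}}(G))$ and its class in $\mathrm K_0(\mathrm C^*_{\mathrm{red}}(G))$ is \[[p_1]=[1]-\Big[\frac1m\sum_{0\le i<m}s^i\Big]-\Big[\frac1n\sum_{0\le j<n}t^j\Big].\]
   Context: The cochain complex is $\ell^2(G)\xrightarrow{d_0}\ell^2(G)^{\oplus2}\xrightarrow{d_1}\ell^2(G)^{\oplus2}\to\cdots$ with $d_0x=((1-s^{-1})x,(1-t^{-1})x)$ and $d_1=\mathrm{diag}(\sum_{0\le i<m}s^i,\sum_{0\le j<n}t^j)$ (group ring elements act by the left regular representation). The first Laplacian is $\Delta_1=d_0d_0^*+d_1^*d_1$ and $p_1$ is the orthogonal projection of $\ell^2(G)^{\oplus2}$ onto $\ker\Delta_1$. *)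

theory Defs
  imports "HOL-Analysis.Analysis"
begin

(* ---------------------------------------------------------------------------
   The group G = Z_m * Z_n, realised concretely by reduced alternating words.
   A letter (False,k) stands for s^k (0<k<m), a letter (True,k) for t^k (0<k<n).
   --------------------------------------------------------------------------- *)

type_synonym word = "(bool \<times> nat) list"

definition ord_of :: "nat \<Rightarrow> nat \<Rightarrow> bool \<Rightarrow> nat" where
  "ord_of m n b = (if b then n else m)"

definition redword :: "nat \<Rightarrow> nat \<Rightarrow> word \<Rightarrow> bool" where
  "redword m n w \<longleftrightarrow>
     (\<forall>(b,k)\<in>set w. 0 < k \<and> k < ord_of m n b) \<and>
     (\<forall>i. Suc i < length w \<longrightarrow> fst (w ! i) \<noteq> fst (w ! Suc i))"

definition gmul1 :: "nat \<Rightarrow> nat \<Rightarrow> bool \<times> nat \<Rightarrow> word \<Rightarrow> word" where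
  "gmul1 m n l w = (let b = fst l; r = ord_of m n b; a = snd l mod r in
     if a = 0 then w else
     (case w of [] \<Rightarrow> [(b, a)]
      | (c, k) # w' \<Rightarrow>
          if c = b then (if (k + a) mod r = 0 then w' else (b, (k + a) mod r) # w')
          else (b, a) # w))"

definition gmul :: "nat \<Rightarrow> nat \<Rightarrow> word \<Rightarrow> word \<Rightarrow> word" where
  "gmul m n g w = foldr (gmul1 m n) g w"

definition ginv :: "nat \<Rightarrow> nat \<Rightarrow> word \<Rightarrow> word" where
  "ginv m n g = rev (map (\<lambda>(b,k). (b, ord_of m n b - k)) g)"

definition spow :: "nat \<Rightarrow> word" where
  "spow i = (if i = 0 then [] else [(False, i)])"

definition tpow :: "nat \<Rightarrow> word" where
  "tpow j = (if j = 0 then [] else [(True, j)])"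

(* ---------------------------------------------------------------------------
   Hilbert spaces l^2(G)^{\<oplus>k}: functions on (component index, group element),
   supported on {..<k} \<times> G, square summable.
   --------------------------------------------------------------------------- *)

type_synonym vec = "nat \<times> word \<Rightarrow> complex"
type_synonym op = "vec \<Rightarrow> vec"

definition l2space :: "nat \<Rightarrow> nat \<Rightarrow> nat \<Rightarrow> vec set" where
  "l2space m n k = {f. (\<forall>i x. f (i, x) \<noteq> 0 \<longrightarrow> i < k \<and> redword m n x) \<and>
                       (\<lambda>p. (cmod (f p))\<^sup>2) summable_on UNIV}"

definition l2inner :: "vec \<Rightarrow> vec \<Rightarrow> complex" where
  "l2inner f g = infsum (\<lambda>p. f p * cnj (g p)) UNIV"

definition l2norm :: "vec \<Rightarrow> real" where
  "l2norm f = sqrt (infsum (\<lambda>p. (cmod (f p))\<^sup>2) UNIV)"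

definition bounded_op :: "nat \<Rightarrow> nat \<Rightarrow> nat \<Rightarrow> nat \<Rightarrow> op \<Rightarrow> bool" where
  "bounded_op m n k j T \<longleftrightarrow>
     (\<forall>f\<in>l2space m n k. T f \<in> l2space m n j) \<and>
     (\<forall>f\<in>l2space m n k. \<forall>g\<in>l2space m n k. T (\<lambda>p. f p + g p) = (\<lambda>p. T f p + T g p)) \<and>
     (\<forall>f\<in>l2space m n k. \<forall>c. T (\<lambda>p. c * f p) = (\<lambda>p. c * T f p)) \<and>
     (\<exists>C. \<forall>f\<in>l2space m n k. l2norm (T f) \<le> C * l2norm f)"

definition opnorm :: "nat \<Rightarrow> nat \<Rightarrow> nat \<Rightarrow> op \<Rightarrow> real" where
  "opnorm m n k T = Sup {l2norm (T f) | f. f \<in> l2space m n k \<and> l2norm f \<le> 1}"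

definition is_adj :: "nat \<Rightarrow> nat \<Rightarrow> nat \<Rightarrow> nat \<Rightarrow> op \<Rightarrow> op \<Rightarrow> bool" where
  "is_adj m n k j T S \<longleftrightarrow>
     (\<forall>f\<in>l2space m n k. \<forall>g\<in>l2space m n j. l2inner (T f) g = l2inner f (S g))"

definition adj :: "nat \<Rightarrow> nat \<Rightarrow> nat \<Rightarrow> nat \<Rightarrow> op \<Rightarrow> op" where
  "adj m n k j T = (\<lambda>g. if g \<in> l2space m n j then
      (THE h. h \<in> l2space m n k \<and> (\<forall>f\<in>l2space m n k. l2inner (T f) g = l2inner f h))
      else (\<lambda>_. 0))"

definition orthproj :: "nat \<Rightarrow> nat \<Rightarrow> nat \<Rightarrow> vec set \<Rightarrow> op" where
  "orthproj m n k K = (\<lambda>f. if f \<in> l2space m n k then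
      (THE g. g \<in> K \<and> (\<forall>h\<in>K. l2inner (\<lambda>p. f p - g p) h = 0))
      else (\<lambda>_. 0))"

definition lreg :: "nat \<Rightarrow> nat \<Rightarrow> word \<Rightarrow> op" where
  "lreg m n g f = (\<lambda>(a, y). if redword m n y then f (a, gmul m n (ginv m n g) y) else 0)"

definition elem_op :: "nat \<Rightarrow> nat \<Rightarrow> nat \<Rightarrow> nat \<Rightarrow> word \<Rightarrow> op" where
  "elem_op m n i j g f = (\<lambda>(a, y). if a = i then lreg m n g f (j, y) else 0)"

text \<open>M_k(C*_red(G)): bounded operators on l^2(G)^k that are operator-norm limits
  of finite combinations of E_{ij} \<otimes> \<lambda>_g, i.e. the norm closure of M_k(\<complex>G).\<close>
definition cstar_mat :: "nat \<Rightarrow> nat \<Rightarrow> nat \<Rightarrow> op \<Rightarrow> bool" where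
  "cstar_mat m n k T \<longleftrightarrow> bounded_op m n k k T \<and>
     (\<forall>\<epsilon>>0. \<exists>F c. finite F \<and> F \<subseteq> {..<k} \<times> {..<k} \<times> Collect (redword m n) \<and>
        opnorm m n k (\<lambda>f p. T f p - (\<Sum>(i,j,g)\<in>F. c (i,j,g) * elem_op m n i j g f p)) \<le> \<epsilon>)"

definition cstar_proj :: "nat \<Rightarrow> nat \<Rightarrow> nat \<Rightarrow> op \<Rightarrow> bool" where
  "cstar_proj m n k P \<longleftrightarrow> cstar_mat m n k P \<and> is_adj m n k k P P \<and>
     (\<forall>f\<in>l2space m n k. P (P f) = P f)"

definition mvn :: "nat \<Rightarrow> nat \<Rightarrow> nat \<Rightarrow> op \<Rightarrow> op \<Rightarrow> bool" where
  "mvn m n N P Q \<longleftrightarrow> (\<exists>V W. cstar_mat m n N V \<and> cstar_mat m n N W \<and> is_adj m n N N V W \<and>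
     (\<forall>f\<in>l2space m n N. W (V f) = P f) \<and> (\<forall>f\<in>l2space m n N. V (W f) = Q f))"

definition block :: "nat \<Rightarrow> nat \<Rightarrow> op \<Rightarrow> op" where
  "block o' k P f = (\<lambda>(a, y). if o' \<le> a \<and> a < o' + k
       then P (\<lambda>(b, z). if b < k then f (b + o', z) else 0) (a - o', y) else 0)"

fun bdiag_aux :: "nat \<Rightarrow> (nat \<times> op) list \<Rightarrow> op" where
  "bdiag_aux o' [] = (\<lambda>f p. 0)"
| "bdiag_aux o' ((k, P) # r) = (\<lambda>f p. block o' k P f p + bdiag_aux (o' + k) r f p)"

definition bdiag :: "(nat \<times> op) list \<Rightarrow> op" where
  "bdiag Ps = bdiag_aux 0 Ps"

definition total_size :: "(nat \<times> op) list \<Rightarrow> nat" where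
  "total_size Ps = sum_list (map fst Ps)"

text \<open>Equality in K_0(C*_red(G)) of sums of classes:
  \<Sum>[P_i] = \<Sum>[Q_j], for projections P_i \<in> M_{k_i}(A), Q_j \<in> M_{l_j}(A)
  (A unital): diag(P_i) \<oplus> 1_r ~ diag(Q_j) \<oplus> 1_r (Murray--von Neumann, after
  padding with zeros) for some r.\<close>
definition k0_eq :: "nat \<Rightarrow> nat \<Rightarrow> (nat \<times> op) list \<Rightarrow> (nat \<times> op) list \<Rightarrow> bool" where
  "k0_eq m n Ps Qs \<longleftrightarrow> (\<forall>(k, P)\<in>set (Ps @ Qs). cstar_proj m n k P) \<and>
     (\<exists>r N. total_size Ps + r \<le> N \<and> total_size Qs + r \<le> N \<and>
        mvn m n N (bdiag (Ps @ [(r, \<lambda>f. f)])) (bdiag (Qs @ [(r, \<lambda>f. f)])))"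

(* ---------------------------------------------------------------------------
   The cochain complex of the presentation complex of <s,t | s^m, t^n>.
   --------------------------------------------------------------------------- *)

definition d0 :: "nat \<Rightarrow> nat \<Rightarrow> op" where
  "d0 m n f = (\<lambda>p. elem_op m n 0 0 [] f p - elem_op m n 0 0 (ginv m n (spow 1)) f p
                 + elem_op m n 1 0 [] f p - elem_op m n 1 0 (ginv m n (tpow 1)) f p)"

definition d1 :: "nat \<Rightarrow> nat \<Rightarrow> op" where
  "d1 m n f = (\<lambda>p. (\<Sum>i<m. elem_op m n 0 0 (spow i) f p) + (\<Sum>j<n. elem_op m n 1 1 (tpow j) f p))"

definition laplace1 :: "nat \<Rightarrow> nat \<Rightarrow> op" where
  "laplace1 m n f = (\<lambda>p. d0 m n (adj m n 1 2 (d0 m n) f) p + adj m n 2 2 (d1 m n) (d1 m n f) p)"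

definition p1 :: "nat \<Rightarrow> nat \<Rightarrow> op" where
  "p1 m n = orthproj m n 2 {f \<in> l2space m n 2. laplace1 m n f = (\<lambda>_. 0)}"

definition avg_s :: "nat \<Rightarrow> nat \<Rightarrow> op" where
  "avg_s m n f = (\<lambda>p. \<Sum>i<m. (1 / of_nat m) * elem_op m n 0 0 (spow i) f p)"

definition avg_t :: "nat \<Rightarrow> nat \<Rightarrow> op" where
  "avg_t m n f = (\<lambda>p. \<Sum>j<n. (1 / of_nat n) * elem_op m n 0 0 (tpow j) f p)"

end

theory Submission
  imports Defs
begin

text \<open>Write \<open>P\<^sub>s\<close>, \<open>P\<^sub>t\<close> for the two averaging projections, so that \<open>ker d\<^sub>1\<close> is the range of
  \<open>diag(1 - P\<^sub>s, 1 - P\<^sub>t)\<close>, and let \<open>L = d\<^sub>0\<^sup>* d\<^sub>0\<close>. A counting argument of paradoxical type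
  gives a spectral gap \<open>L \<ge> c > 0\<close>. Hence \<open>L\<close> has an inverse square root \<open>Z\<close> in the reduced
  C*-algebra; both the square root and its inverse are obtained from Banach's fixed point theorem.
  Then \<open>V = d\<^sub>0 Z\<close> is an isometry whose range is that of \<open>d\<^sub>0\<close>, so that
  \<open>p\<^sub>1 = diag(1 - P\<^sub>s, 1 - P\<^sub>t) - V V\<^sup>*\<close>. In other words \<open>p\<^sub>1\<close>, \<open>P\<^sub>s\<close>, \<open>P\<^sub>t\<close> and \<open>V V\<^sup>* \<sim> 1\<close>
  add up to the unit of the two by two matrices, which yields the identity of classes
  after adding \<open>[1]\<close> to both sides.

  All operators involved have real coefficients, so the C*-algebra is represented by the closed
  real span of the matrix units times group elements, acting on square summable functions on the
  whole index type and vanishing off the reduced words; complex linearity enters through commutation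
  with multiplication by the imaginary unit.\<close>

section \<open>The Hilbert space of square summable functions\<close>

definition square_summable :: "('i \<Rightarrow> complex) \<Rightarrow> bool" where
  "square_summable f \<longleftrightarrow> (\<lambda>p. (cmod (f p))\<^sup>2) summable_on UNIV"

lemma square_summable_zero [simp]: "square_summable (\<lambda>_. 0)"
  by (simp add: square_summable_def)

lemma square_summable_add:
  assumes "square_summable f" "square_summable g"
  shows "square_summable (\<lambda>p. f p + g p)"
proof -
  have "(\<lambda>p. 2 * (cmod (f p))\<^sup>2 + 2 * (cmod (g p))\<^sup>2) summable_on UNIV"
    using assms unfolding square_summable_def
    by (intro summable_on_add summable_on_cmult_right) auto
  then show ?thesis unfolding square_summable_def
  proof (rule summable_on_comparison_test)
    fix p
    have "(cmod (f p + g p))\<^sup>2 \<le> (cmod (f p) + cmod (g p))\<^sup>2"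
      by (intro power_mono norm_triangle_ineq) auto
    also have "\<dots> \<le> 2 * (cmod (f p))\<^sup>2 + 2 * (cmod (g p))\<^sup>2"
      using sum_squares_bound[of "cmod (f p)" "cmod (g p)"] by (simp add: power2_sum)
    finally show "(cmod (f p + g p))\<^sup>2 \<le> 2 * (cmod (f p))\<^sup>2 + 2 * (cmod (g p))\<^sup>2" .
  qed auto
qed

lemma square_summable_cmult:
  assumes "square_summable f"
  shows "square_summable (\<lambda>p. c * f p)"
  using assms unfolding square_summable_def norm_mult power_mult_distrib
  by (rule summable_on_cmult_right)

lemma square_summable_minus:
  assumes "square_summable f"
  shows "square_summable (\<lambda>p. - f p)"
  using square_summable_cmult[OF assms, of "-1"] by simp

lemma square_summable_diff:
  assumes "square_summable f" "square_summable g"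
  shows "square_summable (\<lambda>p. f p - g p)"
  using square_summable_add[OF assms(1) square_summable_minus[OF assms(2)]] by simp

lemma square_summable_mult_cnj:
  assumes "square_summable f" "square_summable g"
  shows "(\<lambda>p. f p * cnj (g p)) summable_on UNIV"
proof -
  have "(\<lambda>p. (cmod (f p))\<^sup>2 + (cmod (g p))\<^sup>2) summable_on UNIV"
    using assms unfolding square_summable_def by (rule summable_on_add)
  then have "(\<lambda>p. norm (f p * cnj (g p))) summable_on UNIV"
  proof (rule summable_on_comparison_test)
    fix p
    show "norm (f p * cnj (g p)) \<le> (cmod (f p))\<^sup>2 + (cmod (g p))\<^sup>2"
      using sum_squares_bound[of "cmod (f p)" "cmod (g p)"]
        mult_nonneg_nonneg[OF norm_ge_zero norm_ge_zero, of "f p" "g p"]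
      unfolding norm_mult complex_mod_cnj by linarith
  qed auto
  then show ?thesis by (rule abs_summable_summable)
qed

typedef 'i ell2 = "{f :: 'i \<Rightarrow> complex. square_summable f}"
  by (rule exI[of _ "\<lambda>_. 0"]) simp

setup_lifting type_definition_ell2

lemma square_summable_Rep_ell2 [simp]: "square_summable (Rep_ell2 x)"
  using Rep_ell2 by auto

lemma Rep_ell2_Abs [simp]: "square_summable f \<Longrightarrow> Rep_ell2 (Abs_ell2 f) = f"
  by (simp add: Abs_ell2_inverse)

lemma ell2_eqI: "(\<And>p. Rep_ell2 x p = Rep_ell2 y p) \<Longrightarrow> x = y"
  using Rep_ell2_inject by blast

definition cinner :: "'i ell2 \<Rightarrow> 'i ell2 \<Rightarrow> complex" where
  "cinner x y = infsum (\<lambda>p. Rep_ell2 x p * cnj (Rep_ell2 y p)) UNIV"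

instantiation ell2 :: (type) real_vector
begin

lift_definition zero_ell2 :: "'a ell2" is "\<lambda>_. 0" by simp
lift_definition plus_ell2 :: "'a ell2 \<Rightarrow> 'a ell2 \<Rightarrow> 'a ell2" is "\<lambda>f g p. f p + g p"
  by (rule square_summable_add)
lift_definition minus_ell2 :: "'a ell2 \<Rightarrow> 'a ell2 \<Rightarrow> 'a ell2" is "\<lambda>f g p. f p - g p"
  by (rule square_summable_diff)
lift_definition uminus_ell2 :: "'a ell2 \<Rightarrow> 'a ell2" is "\<lambda>f p. - f p"
  by (rule square_summable_minus)
lift_definition scaleR_ell2 :: "real \<Rightarrow> 'a ell2 \<Rightarrow> 'a ell2" is "\<lambda>r f p. complex_of_real r * f p"
  by (rule square_summable_cmult)

instance
proof
  fix x y z :: "'a ell2" and a b :: real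
  show "x + y + z = x + (y + z)" by transfer (simp add: add.assoc)
  show "x + y = y + x" by transfer (simp add: add.commute)
  show "0 + x = x" by transfer simp
  show "- x + x = 0" by transfer simp
  show "x - y = x + - y" by transfer simp
  show "a *\<^sub>R (x + y) = a *\<^sub>R x + a *\<^sub>R y" by transfer (simp add: algebra_simps)
  show "(a + b) *\<^sub>R x = a *\<^sub>R x + b *\<^sub>R x" by transfer (simp add: algebra_simps)
  show "a *\<^sub>R b *\<^sub>R x = (a * b) *\<^sub>R x" by transfer (simp add: algebra_simps)
  show "1 *\<^sub>R x = x" by transfer simp
qed

end

text \<open>Taking the real part of the complex inner product leaves the norm unchanged and makes
  bounded real-linear maps and their operator norm available; \<open>cinner_eq_inner\<close>
  recovers the complex product.\<close>

instantiation ell2 :: (type) real_inner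
begin

definition inner_ell2 :: "'a ell2 \<Rightarrow> 'a ell2 \<Rightarrow> real" where
  "inner_ell2 x y = Re (cinner x y)"
definition norm_ell2 :: "'a ell2 \<Rightarrow> real" where
  "norm_ell2 x = sqrt (inner x x)"
definition sgn_ell2 :: "'a ell2 \<Rightarrow> 'a ell2" where
  "sgn_ell2 x = inverse (norm x) *\<^sub>R x"
definition dist_ell2 :: "'a ell2 \<Rightarrow> 'a ell2 \<Rightarrow> real" where
  "dist_ell2 x y = norm (x - y)"
definition uniformity_ell2 :: "('a ell2 \<times> 'a ell2) filter" where
  "uniformity_ell2 = (INF e\<in>{0<..}. principal {(x, y). dist x y < e})"
definition open_ell2 :: "'a ell2 set \<Rightarrow> bool" where
  "open_ell2 U \<longleftrightarrow> (\<forall>x\<in>U. \<forall>\<^sub>F (x', y) in uniformity. x' = x \<longrightarrow> y \<in> U)"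

lemma inner_ell2_has_sum:
  "((\<lambda>p. Re (Rep_ell2 x p * cnj (Rep_ell2 y p))) has_sum inner x y) UNIV"
  unfolding inner_ell2_def cinner_def
  by (intro has_sum_Re has_sum_infsum square_summable_mult_cnj) auto

lemma inner_self_ell2_has_sum:
  "((\<lambda>p. (cmod (Rep_ell2 x p))\<^sup>2) has_sum inner x x) UNIV"
  using inner_ell2_has_sum[of x x] by (simp add: complex_norm_square[symmetric] flip: of_real_power)

instance
proof
  fix x y z :: "'a ell2" and a b :: real
  show "sgn x = x /\<^sub>R norm x" by (simp add: sgn_ell2_def)
  show "dist x y = norm (x - y)" by (simp add: dist_ell2_def)
  show "(uniformity :: ('a ell2 \<times> 'a ell2) filter) = (INF e\<in>{0<..}. principal {(x, y). dist x y < e})"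
    by (simp add: uniformity_ell2_def)
  show "open U \<longleftrightarrow> (\<forall>x\<in>U. \<forall>\<^sub>F (x', y) in uniformity. x' = x \<longrightarrow> y \<in> U)" for U :: "'a ell2 set"
    by (simp add: open_ell2_def)
  show "inner x y = inner y x"
    by (rule has_sum_unique[OF inner_ell2_has_sum[of x y]])
      (use inner_ell2_has_sum[of y x] in \<open>simp add: algebra_simps\<close>)
  show "inner (x + y) z = inner x z + inner y z"
    by (rule has_sum_unique[OF inner_ell2_has_sum[of "x + y" z]])
      (use has_sum_add[OF inner_ell2_has_sum[of x z] inner_ell2_has_sum[of y z]]
        in \<open>simp add: algebra_simps plus_ell2.rep_eq\<close>)
  show "inner (a *\<^sub>R x) y = a * inner x y"
    by (rule has_sum_unique[OF inner_ell2_has_sum[of "a *\<^sub>R x" y]])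
      (use has_sum_cmult_right[OF inner_ell2_has_sum[of x y], of a]
        in \<open>simp add: algebra_simps scaleR_ell2.rep_eq\<close>)
  show ge0: "0 \<le> inner x x"
    by (rule has_sum_nonneg[OF inner_self_ell2_has_sum]) auto
  show "inner x x = 0 \<longleftrightarrow> x = 0"
  proof
    assume 0: "inner x x = 0"
    show "x = 0"
    proof (rule ell2_eqI)
      fix p
      have "sum (\<lambda>p. (cmod (Rep_ell2 x p))\<^sup>2) {p} \<le> inner x x"
        by (rule finite_sum_le_has_sum[OF inner_self_ell2_has_sum]) auto
      then show "Rep_ell2 x p = Rep_ell2 0 p" using 0 by (simp add: zero_ell2.rep_eq)
    qed
  next
    assume "x = 0"
    then show "inner x x = 0"
      using inner_self_ell2_has_sum[of x] by (auto simp: zero_ell2.rep_eq dest: has_sum_0_simp[THEN has_sum_unique])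
  qed
  show "norm x = sqrt (inner x x)" by (simp add: norm_ell2_def)
qed

end

lemma norm_sq_ell2_has_sum: "((\<lambda>p. (cmod (Rep_ell2 x p))\<^sup>2) has_sum (norm x)\<^sup>2) UNIV"
  using inner_self_ell2_has_sum[of x] by (simp add: power2_norm_eq_inner)

lemma norm_ell2_eq: "norm x = sqrt (infsum (\<lambda>p. (cmod (Rep_ell2 x p))\<^sup>2) UNIV)"
  using infsumI[OF norm_sq_ell2_has_sum[of x]] by simp

lemma sum_cmod_le_norm_ell2:
  "finite F \<Longrightarrow> (\<Sum>p\<in>F. (cmod (Rep_ell2 x p))\<^sup>2) \<le> (norm x)\<^sup>2"
  by (rule finite_sum_le_has_sum[OF norm_sq_ell2_has_sum]) auto

lemma cmod_Rep_le_norm: "cmod (Rep_ell2 x p) \<le> norm x"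
  using sum_cmod_le_norm_ell2[of "{p}" x] by (simp add: power2_le_iff_abs_le)

lemma norm_ell2_leI:
  assumes "square_summable f" "0 \<le> e" "\<And>F. finite F \<Longrightarrow> (\<Sum>p\<in>F. (cmod (f p))\<^sup>2) \<le> e\<^sup>2"
  shows "norm (Abs_ell2 f) \<le> e"
proof -
  have "infsum (\<lambda>p. (cmod (f p))\<^sup>2) UNIV \<le> e\<^sup>2"
    using assms by (intro infsum_le_finite_sums) (auto simp: square_summable_def)
  then show ?thesis using assms by (simp add: norm_ell2_eq real_le_lsqrt real_sqrt_le_iff)
qed

text \<open>The limit is taken pointwise, and norm estimates pass to it through finite partial sums,
  where limits may be taken term by term.\<close>

instance ell2 :: (type) complete_space
proof
  fix X :: "nat \<Rightarrow> 'a ell2"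
  assume X: "Cauchy X"
  have "convergent (\<lambda>n. Rep_ell2 (X n) p)" for p
  proof (rule Cauchy_convergent, rule metric_CauchyI)
    fix e :: real assume "e > 0"
    then obtain M where M: "\<And>i j. i \<ge> M \<Longrightarrow> j \<ge> M \<Longrightarrow> dist (X i) (X j) < e"
      using X by (meson metric_CauchyD)
    show "\<exists>M. \<forall>i\<ge>M. \<forall>j\<ge>M. dist (Rep_ell2 (X i) p) (Rep_ell2 (X j) p) < e"
    proof (intro exI[of _ M] allI impI)
      fix i j assume "i \<ge> M" "j \<ge> M"
      have "dist (Rep_ell2 (X i) p) (Rep_ell2 (X j) p) \<le> dist (X i) (X j)"
        using cmod_Rep_le_norm[of "X i - X j" p] by (simp add: dist_norm minus_ell2.rep_eq)
      then show "dist (Rep_ell2 (X i) p) (Rep_ell2 (X j) p) < e"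
        using M[OF \<open>i \<ge> M\<close> \<open>j \<ge> M\<close>] by simp
    qed
  qed
  then obtain f where f: "\<And>p. (\<lambda>n. Rep_ell2 (X n) p) \<longlonglongrightarrow> f p"
    unfolding convergent_def by metis
  have key: "(\<Sum>p\<in>F. (cmod (Rep_ell2 (X i) p - f p))\<^sup>2) \<le> e\<^sup>2"
    if F: "finite F" and M: "\<And>j. j \<ge> i \<Longrightarrow> dist (X i) (X j) \<le> e" for F i e
  proof (rule tendsto_upperbound)
    show "(\<lambda>j. \<Sum>p\<in>F. (cmod (Rep_ell2 (X i) p - Rep_ell2 (X j) p))\<^sup>2)
        \<longlonglongrightarrow> (\<Sum>p\<in>F. (cmod (Rep_ell2 (X i) p - f p))\<^sup>2)"
      by (intro tendsto_intros f)
    show "\<forall>\<^sub>F j in sequentially. (\<Sum>p\<in>F. (cmod (Rep_ell2 (X i) p - Rep_ell2 (X j) p))\<^sup>2) \<le> e\<^sup>2"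
    proof (rule eventually_sequentiallyI[of i])
      fix j assume "j \<ge> i"
      have "(\<Sum>p\<in>F. (cmod (Rep_ell2 (X i) p - Rep_ell2 (X j) p))\<^sup>2) \<le> (norm (X i - X j))\<^sup>2"
        using sum_cmod_le_norm_ell2[OF F, of "X i - X j"] by (simp add: minus_ell2.rep_eq)
      also have "\<dots> \<le> e\<^sup>2"
        using M[OF \<open>j \<ge> i\<close>] by (intro power_mono) (auto simp: dist_norm)
      finally show "(\<Sum>p\<in>F. (cmod (Rep_ell2 (X i) p - Rep_ell2 (X j) p))\<^sup>2) \<le> e\<^sup>2" .
    qed
  qed auto
  have diff: "square_summable (\<lambda>p. Rep_ell2 (X i) p - f p)"
    if "\<And>j. j \<ge> i \<Longrightarrow> dist (X i) (X j) \<le> e" for i e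
    unfolding square_summable_def
    by (rule nonneg_bdd_above_summable_on) (auto intro!: bdd_aboveI[of _ "e\<^sup>2"] key that)
  \<comment> \<open>A single square summable difference \<open>X M1 - f\<close> makes
    \<open>f\<close> itself square summable.\<close>
  obtain M1 where M1: "\<And>i j. i \<ge> M1 \<Longrightarrow> j \<ge> M1 \<Longrightarrow> dist (X i) (X j) < 1"
    using X by (meson metric_CauchyD zero_less_one)
  have "square_summable (\<lambda>p. Rep_ell2 (X M1) p - f p)"
    by (rule diff[of M1 1]) (auto intro: less_imp_le M1)
  from square_summable_diff[OF square_summable_Rep_ell2[of "X M1"] this]
  have ssf: "square_summable f" by simp
  have "X \<longlonglongrightarrow> Abs_ell2 f"
  proof (rule metric_LIMSEQ_I)
    fix e :: real assume "e > 0"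
    then obtain M where M: "\<And>i j. i \<ge> M \<Longrightarrow> j \<ge> M \<Longrightarrow> dist (X i) (X j) < e / 2"
      using X by (meson metric_CauchyD half_gt_zero)
    have "dist (X i) (Abs_ell2 f) < e" if "i \<ge> M" for i
    proof -
      have M': "\<And>j. j \<ge> i \<Longrightarrow> dist (X i) (X j) \<le> e / 2"
        using M that by (meson le_trans less_imp_le)
      have "X i - Abs_ell2 f = Abs_ell2 (\<lambda>p. Rep_ell2 (X i) p - f p)"
        by (rule ell2_eqI) (simp add: minus_ell2.rep_eq ssf diff[OF M'])
      moreover have "norm (Abs_ell2 (\<lambda>p. Rep_ell2 (X i) p - f p)) \<le> e / 2"
        by (rule norm_ell2_leI[OF diff[OF M']]) (use \<open>e > 0\<close> key[OF _ M'] in auto)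
      ultimately show ?thesis using \<open>e > 0\<close> by (simp add: dist_norm)
    qed
    then show "\<exists>M. \<forall>i\<ge>M. dist (X i) (Abs_ell2 f) < e" by blast
  qed
  then show "convergent X" by (rule convergentI)
qed

instance ell2 :: (type) banach ..

lift_definition mult_i :: "'i ell2 \<Rightarrow> 'i ell2" is "\<lambda>f p. \<i> * f p"
  by (rule square_summable_cmult)

text \<open>Entrywise, \<open>Re (x * cnj (\<i> * y)) = Im (x * cnj y)\<close>. Real adjointness
  therefore gives complex adjointness once the adjoint commutes with \<open>mult_i\<close>.\<close>

lemma cinner_eq_inner: "cinner x y = Complex (inner x y) (inner x (mult_i y))"
proof (rule complex_eqI)
  have "((\<lambda>p. Im (Rep_ell2 x p * cnj (Rep_ell2 y p))) has_sum Im (cinner x y)) UNIV"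
    unfolding cinner_def by (intro has_sum_Im has_sum_infsum square_summable_mult_cnj) auto
  with inner_ell2_has_sum[of x "mult_i y"]
  show "Im (cinner x y) = Im (Complex (inner x y) (inner x (mult_i y)))"
    by (simp add: mult_i.rep_eq algebra_simps has_sum_unique)
qed (simp add: inner_ell2_def)

section \<open>Reduced words in a free product of two cyclic groups\<close>

locale cyclic_free_product =
  fixes m n :: nat
  assumes m_ge: "m \<ge> 2" and n_ge: "n \<ge> 3"
begin

abbreviation "ord \<equiv> ord_of m n"
abbreviation "red \<equiv> redword m n"
abbreviation "mul1 \<equiv> gmul1 m n"
abbreviation "mul \<equiv> gmul m n"
abbreviation "inverse_word \<equiv> ginv m n"

lemma ord_ge: "ord b \<ge> 2"
  using m_ge n_ge by (simp add: ord_of_def)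

lemma ord_pos: "ord b > 0"
  using ord_ge[of b] by linarith

lemma red_successively:
  "red w \<longleftrightarrow> (\<forall>(b,k)\<in>set w. 0 < k \<and> k < ord b) \<and> successively (\<lambda>x y. fst x \<noteq> fst y) w"
  by (simp add: redword_def successively_conv_nth)

lemma red_Nil [simp]: "red []"
  by (simp add: redword_def)

lemma red_Cons:
  "red ((b, k) # w) \<longleftrightarrow> 0 < k \<and> k < ord b \<and> (w = [] \<or> fst (hd w) \<noteq> b) \<and> red w"
  by (cases w) (auto simp: red_successively)

lemma red_mul1: "red w \<Longrightarrow> red (mul1 l w)"
  by (cases l; cases w) (auto simp: gmul1_def Let_def red_Cons ord_pos)

lemma mul1_mod_zero: "k mod ord b = 0 \<Longrightarrow> mul1 (b, k) w = w"
  by (simp add: gmul1_def)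

text \<open>For a tail \<open>v\<close> not starting in the factor \<open>b\<close>, the leading
  power becomes a coordinate modulo \<open>ord b\<close>; exponent zero stands for no letter at
  all.\<close>

definition prepend :: "bool \<Rightarrow> nat \<Rightarrow> word \<Rightarrow> word" where
  "prepend b k v = (if k mod ord b = 0 then v else (b, k mod ord b) # v)"

lemma red_eq_prependE:
  assumes "red w"
  obtains k v where "w = prepend b k v" "k < ord b" "red v" "v = [] \<or> fst (hd v) \<noteq> b"
proof (cases "w \<noteq> [] \<and> fst (hd w) = b")
  case True
  then obtain k v where "w = (b, k) # v" by (cases w) auto
  then show ?thesis using assms that[of k v] by (auto simp: red_Cons prepend_def)
next
  case False
  then show ?thesis using assms that[of 0 w] by (auto simp: prepend_def ord_pos)
qed

text \<open>In this coordinate the merging, cancelling and prepending cases of \<open>gmul1\<close>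
  all become addition of exponents.\<close>

lemma mul1_prepend:
  assumes "v = [] \<or> fst (hd v) \<noteq> b"
  shows "mul1 (b, i) (prepend b k v) = prepend b (i + k) v"
proof -
  have "(i + k) mod ord b = k mod ord b" if "i mod ord b = 0"
    using that by (metis add.left_neutral mod_add_left_eq)
  moreover have "(k mod ord b + i mod ord b) mod ord b = (i + k) mod ord b"
    by (simp add: mod_add_eq add.commute)
  moreover have "(i + k) mod ord b = i mod ord b" if "k mod ord b = 0"
    using that by (metis add.right_neutral mod_add_right_eq)
  ultimately show ?thesis
    using assms by (cases v) (auto simp: gmul1_def Let_def prepend_def)
qed

lemma mul1_mul1:
  assumes "red w"
  shows "mul1 (b, i) (mul1 (b, j) w) = mul1 (b, i + j) w"
proof -
  obtain k v where w: "w = prepend b k v" "v = [] \<or> fst (hd v) \<noteq> b"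
    using red_eq_prependE[OF assms] by metis
  show ?thesis using w(2) by (simp only: w(1) mul1_prepend add.assoc)
qed

lemma mul_Nil [simp]: "mul [] w = w"
  by (simp add: gmul_def)

lemma mul_Cons [simp]: "mul (l # g) w = mul1 l (mul g w)"
  by (simp add: gmul_def)

lemma mul_append: "mul (g @ h) w = mul g (mul h w)"
  by (induction g) auto

lemma red_mul: "red w \<Longrightarrow> red (mul g w)"
  by (induction g) (auto intro: red_mul1)

text \<open>Only the contact of \<open>l\<close> with the first letter of \<open>g\<close> matters:
  letters of the same factor fuse by \<open>mul1_mul1\<close>, otherwise \<open>l\<close> is put in
  front. Associativity then follows by induction on the left factor.\<close>

lemma mul_mul1:
  assumes "red w" "red g"
  shows "mul (mul1 l g) w = mul1 l (mul g w)"
proof -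
  obtain b k where l: "l = (b, k)" by force
  have c: "mul1 (b, k mod ord b) v = mul1 (b, k) v" for v
    by (simp add: gmul1_def)
  show ?thesis
  proof (cases g)
    case Nil
    then show ?thesis using c by (auto simp: l gmul1_def Let_def)
  next
    case (Cons a g')
    obtain b' j where a: "a = (b', j)" by force
    have g': "red (mul g' w)" by (rule red_mul[OF assms(1)])
    have c2: "mul1 (b, i mod ord b) v = mul1 (b, i) v" for v i
      by (simp add: gmul1_def)
    show ?thesis
    proof (cases "k mod ord b = 0")
      case True
      then show ?thesis by (simp add: l mul1_mod_zero)
    next
      case False
      show ?thesis
      proof (cases "b' = b")
        case True
        have "mul (mul1 l g) w = mul1 (b, (j + k mod ord b) mod ord b) (mul g' w)"
          using False True by (auto simp: l Cons a gmul1_def Let_def)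
        also have "\<dots> = mul1 (b, k + j) (mul g' w)"
          by (simp add: c2 mod_add_right_eq gmul1_def add.commute)
        also have "\<dots> = mul1 l (mul g w)"
          using mul1_mul1[OF g', of b k j] by (simp add: l Cons a True)
        finally show ?thesis .
      next
        case False2: False
        have "mul1 l g = (b, k mod ord b) # g"
          using False False2 by (simp add: l Cons a gmul1_def)
        then show ?thesis by (simp add: c l)
      qed
    qed
  qed
qed

lemma mul_assoc:
  assumes "red w" "red h"
  shows "mul (mul g h) w = mul g (mul h w)"
  by (induction g) (simp_all add: mul_mul1 assms red_mul)

lemma red_inverse: "red g \<Longrightarrow> red (inverse_word g)"
  by (auto simp: red_successively ginv_def successively_rev successively_map
      case_prod_unfold intro: successively_mono)

lemma inverse_inverse: "red g \<Longrightarrow> inverse_word (inverse_word g) = g"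
  unfolding ginv_def rev_map by (auto simp: red_successively intro!: map_idI)

lemma mul_inverse_mul:
  assumes "red w" "red g"
  shows "mul (inverse_word g) (mul g w) = w"
  using assms
proof (induction g arbitrary: w)
  case (Cons l g)
  obtain b k where l: "l = (b, k)" by force
  have k: "k \<le> ord b" "red g" using Cons.prems by (auto simp: l red_Cons)
  have "mul (inverse_word (l # g)) (mul (l # g) w)
      = mul (inverse_word g) (mul1 (b, ord b - k) (mul1 (b, k) (mul g w)))"
    by (simp add: ginv_def l mul_append)
  also have "mul1 (b, ord b - k) (mul1 (b, k) (mul g w)) = mul g w"
    using k by (subst mul1_mul1) (auto simp: red_mul Cons.prems mul1_mod_zero)
  finally show ?case using Cons k by simp
qed (simp add: ginv_def)

lemma mul_mul_inverse:
  "red w \<Longrightarrow> red g \<Longrightarrow> mul g (mul (inverse_word g) w) = w"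
  using mul_inverse_mul[of w "inverse_word g"] by (simp add: red_inverse inverse_inverse)

text \<open>Inverses are compared through their action: \<open>mul g h\<close> carries the
  right-hand side to \<open>w\<close>, and cancelling it gives the claim.\<close>

lemma mul_inverse_of_mul:
  assumes "red w" "red g" "red h"
  shows "mul (inverse_word (mul g h)) w = mul (inverse_word h) (mul (inverse_word g) w)"
proof -
  let ?z = "mul (inverse_word h) (mul (inverse_word g) w)"
  have "mul (mul g h) ?z = w"
    using assms by (simp add: mul_assoc red_mul mul_mul_inverse)
  then show ?thesis
    using mul_inverse_mul[of ?z "mul g h"] assms by (simp add: red_mul)
qed

end

section \<open>The operator algebra\<close>

type_synonym l2op = "(nat \<times> word) ell2 \<Rightarrow>\<^sub>L (nat \<times> word) ell2"

lemma subspace_closure: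
  fixes S :: "'a::real_normed_vector set"
  assumes "subspace S"
  shows "subspace (closure S)"
proof (rule subspaceI)
  show "0 \<in> closure S" using assms closure_subset subspace_0 by blast
next
  fix x y assume "x \<in> closure S" "y \<in> closure S"
  then obtain f g where "\<And>n. f n \<in> S" "f \<longlonglongrightarrow> x" "\<And>n. g n \<in> S" "g \<longlonglongrightarrow> y"
    by (auto simp: closure_sequential)
  then have "\<forall>n. f n + g n \<in> S" "(\<lambda>n. f n + g n) \<longlonglongrightarrow> x + y"
    using assms by (auto intro: subspace_add tendsto_add)
  then show "x + y \<in> closure S" unfolding closure_sequential by (intro exI[of _ "\<lambda>n. f n + g n"]) auto
next
  fix c x assume "x \<in> closure S"
  then obtain f where "\<And>n. f n \<in> S" "f \<longlonglongrightarrow> x" by (auto simp: closure_sequential)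
  then have "\<forall>n. c *\<^sub>R f n \<in> S" "(\<lambda>n. c *\<^sub>R f n) \<longlonglongrightarrow> c *\<^sub>R x"
    using assms by (auto intro: subspace_scale tendsto_intros)
  then show "c *\<^sub>R x \<in> closure S" unfolding closure_sequential by (intro exI[of _ "\<lambda>n. c *\<^sub>R f n"]) auto
qed

lemma closure_span_minimal:
  fixes G :: "'a::real_normed_vector set"
  assumes "G \<subseteq> S" "subspace S" "closed S"
  shows "closure (span G) \<subseteq> S"
  by (intro closure_minimal span_minimal assms)

lemma subspace_vimage_bounded_linear:
  assumes "bounded_linear f" "subspace S" 
  shows "subspace (f -` S)"
  using assms bounded_linear.linear linear_subspace_vimage by blast

lemma closed_vimage_bounded_linear:
  assumes "bounded_linear f" "closed S" 
  shows "closed (f -` S)"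
  using assms by (intro closed_vimage linear_continuous_on) (auto simp: linear_continuous_at continuous_at_imp_continuous_on)

text \<open>A relation rather than an operation, since every adjoint below is written down
  explicitly.\<close>

definition is_adjoint :: "('a::real_inner \<Rightarrow>\<^sub>L 'b::real_inner) \<Rightarrow> ('b \<Rightarrow>\<^sub>L 'a) \<Rightarrow> bool" where
  "is_adjoint A B \<longleftrightarrow> (\<forall>x y. inner (A x) y = inner x (B y))"

lemma is_adjointD: "is_adjoint A B \<Longrightarrow> inner (A x) y = inner x (B y)"
  by (simp add: is_adjoint_def)

lemma is_adjointD': "is_adjoint A B \<Longrightarrow> inner (B x) y = inner x (A y)"
  by (metis is_adjoint_def inner_commute)

lemma is_adjoint_sym: "is_adjoint A B \<Longrightarrow> is_adjoint B A"
  by (simp add: is_adjointD' is_adjoint_def[of B])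

lemma is_adjoint_compose: "is_adjoint A A' \<Longrightarrow> is_adjoint B B' \<Longrightarrow> is_adjoint (A o\<^sub>L B) (B' o\<^sub>L A')"
  by (simp add: is_adjoint_def)

lemma is_adjoint_add: "is_adjoint A A' \<Longrightarrow> is_adjoint B B' \<Longrightarrow> is_adjoint (A + B) (A' + B')"
  by (simp add: is_adjoint_def blinfun.add_left inner_add_left inner_add_right)

lemma is_adjoint_diff: "is_adjoint A A' \<Longrightarrow> is_adjoint B B' \<Longrightarrow> is_adjoint (A - B) (A' - B')"
  by (simp add: is_adjoint_def blinfun.diff_left inner_diff_left inner_diff_right)

lemma is_adjoint_scaleR: "is_adjoint A A' \<Longrightarrow> is_adjoint (c *\<^sub>R A) (c *\<^sub>R A')"
  by (simp add: is_adjoint_def blinfun.scaleR_left)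

lemma is_adjoint_zero: "is_adjoint 0 0"
  by (simp add: is_adjoint_def)

lemma is_adjoint_sum:
  "(\<And>i. i \<in> I \<Longrightarrow> is_adjoint (A i) (B i)) \<Longrightarrow> is_adjoint (\<Sum>i\<in>I. A i) (\<Sum>i\<in>I. B i)"
  by (induction I rule: infinite_finite_induct) (auto intro: is_adjoint_add is_adjoint_zero)

lemma is_adjoint_unique: "is_adjoint A B \<Longrightarrow> is_adjoint A C \<Longrightarrow> B = C"
  by (intro blinfun_eqI) (metis is_adjointD vector_eq_ldot)

context cyclic_free_product
begin

section \<open>Matrix units times group elements as bounded operators\<close>

lemma elem_op_apply:
  "elem_op m n i j g f (a, y) = (if a = i \<and> red y then f (j, mul (inverse_word g) y) else 0)"
  by (simp add: elem_op_def lreg_def)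

text \<open>The substitution \<open>?\<phi>\<close> is injective on the reduced positions of row
  \<open>i\<close>, so the left side sums distinct entries of \<open>x\<close>.\<close>

lemma elem_op_sum_le:
  assumes g: "red g" and F: "finite F"
  shows "(\<Sum>p\<in>F. (cmod (elem_op m n i j g (Rep_ell2 x) p))\<^sup>2) \<le> (norm x)\<^sup>2"
proof -
  let ?\<phi> = "\<lambda>p. (j, mul (inverse_word g) (snd p))"
  let ?F = "{p \<in> F. fst p = i \<and> red (snd p)}"
  have inj: "inj_on ?\<phi> ?F"
    by (rule inj_on_inverseI[of _ "\<lambda>q. (i, mul g (snd q))"]) (auto simp: mul_mul_inverse g)
  have "(\<Sum>p\<in>F. (cmod (elem_op m n i j g (Rep_ell2 x) p))\<^sup>2)
      = (\<Sum>p\<in>?F. (cmod (elem_op m n i j g (Rep_ell2 x) p))\<^sup>2)"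
    using F by (intro sum.mono_neutral_right) (auto simp: elem_op_apply split: if_splits)
  also have "\<dots> = (\<Sum>p\<in>?F. (cmod (Rep_ell2 x (?\<phi> p)))\<^sup>2)"
    by (intro sum.cong) (auto simp: elem_op_apply)
  also have "\<dots> = (\<Sum>q\<in>?\<phi> ` ?F. (cmod (Rep_ell2 x q))\<^sup>2)"
    by (simp add: sum.reindex[OF inj])
  also have "\<dots> \<le> (norm x)\<^sup>2"
    using F by (intro sum_cmod_le_norm_ell2) auto
  finally show ?thesis .
qed

lemma square_summable_elem_op:
  assumes "red g"
  shows "square_summable (elem_op m n i j g (Rep_ell2 x))"
  unfolding square_summable_def
  by (rule nonneg_bdd_above_summable_on) (auto intro!: bdd_aboveI[of _ "(norm x)\<^sup>2"] elem_op_sum_le assms)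

text \<open>The operator \<open>E_ij \<otimes> \<lambda>_g\<close>. It reads and writes reduced
  positions only.\<close>

definition U :: "nat \<Rightarrow> nat \<Rightarrow> word \<Rightarrow> l2op" where
  "U i j g = Blinfun (\<lambda>x. Abs_ell2 (elem_op m n i j g (Rep_ell2 x)))"

lemma bounded_linear_elem_op:
  assumes g: "red g"
  shows "bounded_linear (\<lambda>x. Abs_ell2 (elem_op m n i j g (Rep_ell2 x)))"
    (is "bounded_linear ?T")
proof (rule bounded_linear_intro[where K = 1])
  have T: "Rep_ell2 (?T x) (a, y) = (if a = i \<and> red y then Rep_ell2 x (j, mul (inverse_word g) y) else 0)"
    for x a y by (simp add: square_summable_elem_op g elem_op_apply)
  show "norm (?T x) \<le> norm x * 1" for x
    by (simp, rule norm_ell2_leI) (auto intro: square_summable_elem_op elem_op_sum_le g)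
  show "?T (x + y) = ?T x + ?T y" for x y
    by (rule ell2_eqI, clarify) (unfold plus_ell2.rep_eq[of "?T x"] T, simp add: plus_ell2.rep_eq)
  show "?T (r *\<^sub>R x) = r *\<^sub>R ?T x" for r x
    by (rule ell2_eqI, clarify) (unfold scaleR_ell2.rep_eq[of r "?T x"] T, simp add: scaleR_ell2.rep_eq)
qed

lemma Rep_U:
  assumes "red g"
  shows "Rep_ell2 (U i j g x) = elem_op m n i j g (Rep_ell2 x)"
  by (simp add: U_def bounded_linear_Blinfun_apply bounded_linear_elem_op square_summable_elem_op assms)

lemma U_apply:
  assumes "red g"
  shows "Rep_ell2 (U i j g x) (a, y) = (if a = i \<and> red y then Rep_ell2 x (j, mul (inverse_word g) y) else 0)"
  by (simp add: Rep_U assms elem_op_apply)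

lemma U_compose:
  assumes "red g" "red h"
  shows "U i j g o\<^sub>L U k l h = (if j = k then U i l (mul g h) else 0)"
proof (rule blinfun_eqI, rule ell2_eqI)
  fix x and p :: "nat \<times> word"
  obtain a y where p: "p = (a, y)" by force
  show "Rep_ell2 ((U i j g o\<^sub>L U k l h) x) p = Rep_ell2 ((if j = k then U i l (mul g h) else 0) x) p"
    by (auto simp: p U_apply assms red_mul mul_inverse_of_mul zero_ell2.rep_eq)
qed

text \<open>Left multiplication by the inverse of \<open>g\<close> permutes the reduced words, so
  both inner products reindex to one sum over row \<open>i\<close>.\<close>

lemma U_adjoint:
  assumes g: "red g"
  shows "is_adjoint (U i j g) (U j i (inverse_word g))"
  unfolding is_adjoint_def
proof (intro allI)
  fix x y
  let ?A = "{i} \<times> Collect red" and ?B = "{j} \<times> Collect red"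
  let ?f = "\<lambda>q. Re (Rep_ell2 x q * cnj (Rep_ell2 (U j i (inverse_word g) y) q))"
  let ?\<phi> = "\<lambda>p. (j, mul (inverse_word g) (snd p))"
  have bij: "bij_betw ?\<phi> ?A ?B"
    by (rule bij_betw_byWitness[where f' = "\<lambda>q. (i, mul g (snd q))"])
      (auto simp: mul_mul_inverse mul_inverse_mul g red_mul)
  have "(?f has_sum inner x (U j i (inverse_word g) y)) ?B"
    using inner_ell2_has_sum[of x "U j i (inverse_word g) y"]
    by (rule has_sum_cong_neutral[THEN iffD1, rotated 3])
      (auto simp: U_apply red_inverse g split: if_splits)
  then have 1: "((\<lambda>p. ?f (?\<phi> p)) has_sum inner x (U j i (inverse_word g) y)) ?A"
    by (simp only: has_sum_reindex_bij_betw[OF bij, of ?f])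
  have 2: "((\<lambda>p. ?f (?\<phi> p)) has_sum inner (U i j g x) y) ?A"
    using inner_ell2_has_sum[of "U i j g x" y]
    by (rule has_sum_cong_neutral[THEN iffD1, rotated 3])
      (auto simp: U_apply red_inverse g inverse_inverse mul_mul_inverse red_mul split: if_splits)
  show "inner (U i j g x) y = inner x (U j i (inverse_word g) y)"
    by (rule has_sum_unique[OF 2 1])
qed

lemma U_mult_i: "red g \<Longrightarrow> U i j g (mult_i x) = mult_i (U i j g x)"
  by (rule ell2_eqI) (auto simp: Rep_U mult_i.rep_eq elem_op_def lreg_def)

section \<open>The closed algebra generated by these operators, and its unit\<close>

definition gens :: "nat \<Rightarrow> l2op set" where
  "gens k = {U i j g |i j g. i < k \<and> j < k \<and> red g}"

definition alg :: "nat \<Rightarrow> l2op set" where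
  "alg k = closure (span (gens k))"

lemma subspace_alg: "subspace (alg k)"
  unfolding alg_def by (rule subspace_closure) simp

lemma closed_alg: "closed (alg k)"
  by (simp add: alg_def)

lemmas alg_add = subspace_add[OF subspace_alg]
lemmas alg_diff = subspace_diff[OF subspace_alg]
lemmas alg_scaleR = subspace_scale[OF subspace_alg]
lemmas alg_sum = subspace_sum[OF subspace_alg]

lemma U_in_alg: "i < k \<Longrightarrow> j < k \<Longrightarrow> red g \<Longrightarrow> U i j g \<in> alg k"
  unfolding alg_def by (intro subsetD[OF closure_subset] span_base) (auto simp: gens_def)

lemma alg_mono: "k \<le> l \<Longrightarrow> alg k \<subseteq> alg l"
  unfolding alg_def by (intro closure_mono span_mono) (fastforce simp: gens_def)

text \<open>The induction principle for the closure: a linear and norm closed property has to be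
  checked on generators only.\<close>

lemma alg_minimal:
  assumes "A \<in> alg k" "\<And>i j g. i < k \<Longrightarrow> j < k \<Longrightarrow> red g \<Longrightarrow> U i j g \<in> S" "subspace S" "closed S"
  shows "A \<in> S"
proof -
  have "closure (span (gens k)) \<subseteq> S"
    using assms(2-) by (intro closure_span_minimal) (auto simp: gens_def)
  then show ?thesis using assms(1) by (auto simp: alg_def)
qed

text \<open>Two passes of \<open>alg_minimal\<close>: first a generator on the left with the right
  factor varying, then the left factor varying for fixed \<open>B\<close>.\<close>

lemma alg_compose:
  assumes A: "A \<in> alg k" and B: "B \<in> alg k"
  shows "A o\<^sub>L B \<in> alg k"
proof -
  note bl = bounded_bilinear.bounded_linear_left[OF bounded_bilinear_blinfun_compose]
    bounded_bilinear.bounded_linear_right[OF bounded_bilinear_blinfun_compose]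
  have 1: "U i j g o\<^sub>L B \<in> alg k" if "i < k" "j < k" "red g" for i j g
  proof -
    have "B \<in> (\<lambda>B. U i j g o\<^sub>L B) -` alg k"
      by (rule alg_minimal[OF B])
        (auto simp: U_compose that red_mul intro: U_in_alg subspace_0[OF subspace_alg]
          intro!: subspace_vimage_bounded_linear closed_vimage_bounded_linear bl subspace_alg closed_alg)
    then show ?thesis by simp
  qed
  have "A \<in> (\<lambda>A. A o\<^sub>L B) -` alg k"
    by (rule alg_minimal[OF A])
      (auto intro: 1 intro!: subspace_vimage_bounded_linear closed_vimage_bounded_linear bl subspace_alg closed_alg)
  then show ?thesis by simp
qed

text \<open>Puts identities that are linear in \<open>A\<close> into the form
  \<open>alg_minimal\<close> consumes; complex linearity and the unit laws spread to the whole
  algebra this way.\<close>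

lemma closed_blinfun_eq:
  assumes "bounded_linear f" "bounded_linear h"
  shows "closed {A. f A = h A}" "subspace {A. f A = h A}"
proof -
  show "closed {A. f A = h A}"
    using assms by (intro closed_Collect_eq) (auto simp: linear_continuous_at continuous_at_imp_continuous_on)
  interpret f: bounded_linear f by fact
  interpret h: bounded_linear h by fact
  show "subspace {A. f A = h A}"
    by (rule subspaceI) (auto simp: f.zero h.zero f.add h.add f.scaleR h.scaleR)
qed

lemma bounded_linear_mult_i: "bounded_linear mult_i"
proof (rule bounded_linear_intro[where K = 1])
  show "norm (mult_i x) \<le> norm x * 1" for x :: "'i ell2"
    by (simp add: norm_ell2_eq mult_i.rep_eq norm_mult)
qed (rule ell2_eqI; simp add: mult_i.rep_eq plus_ell2.rep_eq scaleR_ell2.rep_eq algebra_simps)+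

lemma alg_mult_i:
  assumes "A \<in> alg k"
  shows "A (mult_i x) = mult_i (A x)"
proof -
  have bl: "bounded_linear (\<lambda>A::l2op. A x)" for x
    by (rule blinfun.bounded_linear_left)
  have "A \<in> {A. blinfun_apply A (mult_i x) = mult_i (blinfun_apply A x)}"
    by (rule alg_minimal[OF assms])
     (auto simp: U_mult_i intro!: closed_blinfun_eq bl bounded_linear_compose[OF bounded_linear_mult_i])
  then show ?thesis by simp
qed

text \<open>The unit of \<open>alg k\<close> is not the identity of the ambient space but the
  projection onto the reduced positions of the first \<open>k\<close> components.\<close>

definition one_mat :: "nat \<Rightarrow> l2op" where
  "one_mat k = (\<Sum>i<k. U i i [])"

lemma inverse_Nil [simp]: "inverse_word [] = []"
  by (simp add: ginv_def)

lemma Rep_sum: "Rep_ell2 (\<Sum>i\<in>I. f i) p = (\<Sum>i\<in>I. Rep_ell2 (f i) p)"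
  by (induction I rule: infinite_finite_induct) (auto simp: zero_ell2.rep_eq plus_ell2.rep_eq)

lemma one_mat_apply:
  "Rep_ell2 (one_mat k x) (a, y) = (if a < k \<and> red y then Rep_ell2 x (a, y) else 0)"
  by (auto simp: one_mat_def blinfun.sum_left Rep_sum U_apply cong: if_cong)

lemma one_mat_in_alg: "one_mat k \<in> alg k"
  unfolding one_mat_def by (intro alg_sum U_in_alg) auto

lemma one_mat_U: 
  assumes "i < k" "red g"
  shows "one_mat k o\<^sub>L U i j g = U i j g" "U j i g o\<^sub>L one_mat k = U j i g"
  by (rule blinfun_eqI, rule ell2_eqI, clarify, simp add: one_mat_apply U_apply assms red_mul red_inverse)+

lemma one_mat_compose:
  assumes "A \<in> alg k"
  shows "one_mat k o\<^sub>L A = A" "A o\<^sub>L one_mat k = A"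
proof -
  note bl = bounded_bilinear.bounded_linear_left[OF bounded_bilinear_blinfun_compose]
    bounded_bilinear.bounded_linear_right[OF bounded_bilinear_blinfun_compose]
  have "A \<in> {A. one_mat k o\<^sub>L A = A}"
    by (rule alg_minimal[OF assms]) (auto simp: one_mat_U intro!: closed_blinfun_eq bl bounded_linear_ident)
  then show "one_mat k o\<^sub>L A = A" by simp
  have "A \<in> {A. A o\<^sub>L one_mat k = A}"
    by (rule alg_minimal[OF assms]) (auto simp: one_mat_U intro!: closed_blinfun_eq bl bounded_linear_ident)
  then show "A o\<^sub>L one_mat k = A" by simp
qed

lemma one_mat_adjoint: "is_adjoint (one_mat k) (one_mat k)"
  unfolding one_mat_def using U_adjoint[of "[]"] by (intro is_adjoint_sum) auto

text \<open>The copy of \<open>l2space m n k\<close> inside the ambient space, described as a fixed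
  space so that membership becomes an operator equation.\<close>

definition comps :: "nat \<Rightarrow> (nat \<times> word) ell2 set" where
  "comps k = {x. one_mat k x = x}"

lemma Rep_in_l2space: "Rep_ell2 x \<in> l2space m n k \<longleftrightarrow> x \<in> comps k"
proof
  assume "Rep_ell2 x \<in> l2space m n k"
  then show "x \<in> comps k"
    unfolding comps_def l2space_def by (auto intro!: ell2_eqI simp: one_mat_apply; blast)
next
  assume "x \<in> comps k"
  then have "one_mat k x = x" by (simp add: comps_def)
  then have "Rep_ell2 x (i, y) = (if i < k \<and> red y then Rep_ell2 x (i, y) else 0)" for i y
    using one_mat_apply[of k x i y] by simp
  then have "\<forall>i y. Rep_ell2 x (i, y) \<noteq> 0 \<longrightarrow> i < k \<and> red y"
    by metis
  then show "Rep_ell2 x \<in> l2space m n k"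
    using square_summable_Rep_ell2[of x] unfolding square_summable_def l2space_def by blast
qed

lemma l2spaceE:
  assumes "f \<in> l2space m n k"
  obtains x where "f = Rep_ell2 x" "x \<in> comps k"
proof -
  have "square_summable f" using assms by (simp add: l2space_def square_summable_def)
  then have "f = Rep_ell2 (Abs_ell2 f)" by simp
  then show ?thesis using that assms Rep_in_l2space by metis
qed

lemma alg_in_comps: "A \<in> alg k \<Longrightarrow> A x \<in> comps k"
  using blinfun_apply_blinfun_compose[of "one_mat k" A x] by (simp add: one_mat_compose(1) comps_def)

lemma l2norm_Rep: "l2norm (Rep_ell2 x) = norm x"
  by (simp add: l2norm_def norm_ell2_eq)

lemma l2inner_Rep: "l2inner (Rep_ell2 x) (Rep_ell2 y) = cinner x y"
  by (simp add: l2inner_def cinner_def)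

end

section \<open>Inverse square roots of coercive operators\<close>

lemma closed_self_adjoint: "closed {Y. is_adjoint Y (Y :: 'a::real_inner \<Rightarrow>\<^sub>L 'a)}"
proof -
  have "{Y. is_adjoint Y (Y :: 'a \<Rightarrow>\<^sub>L 'a)}
      = (\<Inter>x. \<Inter>y. {Y. inner (blinfun_apply Y x) y = inner x (blinfun_apply Y y)})"
    by (auto simp: is_adjoint_def)
  also have "closed \<dots>"
    by (intro closed_INT ballI closed_Collect_eq continuous_intros)
  finally show ?thesis .
qed

lemmas blinfun_compose_linear =
  bounded_bilinear.add_left[OF bounded_bilinear_blinfun_compose]
  bounded_bilinear.add_right[OF bounded_bilinear_blinfun_compose]
  bounded_bilinear.diff_left[OF bounded_bilinear_blinfun_compose]
  bounded_bilinear.diff_right[OF bounded_bilinear_blinfun_compose]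
  bounded_bilinear.scaleR_left[OF bounded_bilinear_blinfun_compose]
  bounded_bilinear.scaleR_right[OF bounded_bilinear_blinfun_compose]
  bounded_bilinear.sum_left[OF bounded_bilinear_blinfun_compose]
  bounded_bilinear.sum_right[OF bounded_bilinear_blinfun_compose]

lemmas blinfun_linear =
  blinfun.add_left blinfun.add_right blinfun.diff_left blinfun.diff_right
  blinfun.scaleR_left blinfun.scaleR_right blinfun.zero_left blinfun.zero_right

text \<open>The unit \<open>E\<close> is only a self-adjoint idempotent, because the algebras in
  question occupy a corner of all operators.\<close>

locale closed_operator_algebra =
  fixes \<A> :: "('a::{real_inner, banach} \<Rightarrow>\<^sub>L 'a) set" and E
  assumes subspace: "subspace \<A>" and closed: "closed \<A>"
    and compose: "\<And>A B. A \<in> \<A> \<Longrightarrow> B \<in> \<A> \<Longrightarrow> A o\<^sub>L B \<in> \<A>"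
    and unit: "E \<in> \<A>" and unit_left: "\<And>A. A \<in> \<A> \<Longrightarrow> E o\<^sub>L A = A"
    and unit_right: "\<And>A. A \<in> \<A> \<Longrightarrow> A o\<^sub>L E = A"
    and unit_adjoint: "is_adjoint E E"
begin

lemma norm_unit_le: "norm (E x) \<le> norm x"
proof -
  have "(norm (E x))\<^sup>2 = inner (E (E x)) x"
    using is_adjointD[OF unit_adjoint, of "E x" x] by (simp add: power2_norm_eq_inner)
  also have "E (E x) = E x"
    using unit_left[OF unit] by (metis blinfun_apply_blinfun_compose)
  also have "inner (E x) x \<le> norm (E x) * norm x" by (rule norm_cauchy_schwarz)
  finally show ?thesis
    by (cases "norm (E x) = 0") (auto simp: power2_eq_square)
qed

text \<open>With the root written as \<open>E - Y\<close>, the equation becomes the fixed point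
  problem \<open>Y = (X + Y Y) / 2\<close> on self-adjoint elements of a small ball.\<close>

lemma sqrt_exists:
  assumes X: "X \<in> \<A>" "is_adjoint X X" and r: "norm X \<le> r" "r < 1"
  obtains Y where "Y \<in> \<A>" "is_adjoint Y Y" "norm Y < 1" "(E - Y) o\<^sub>L (E - Y) = E - X"
proof -
  \<comment> \<open>The smaller root of \<open>r + \<rho> * \<rho> = 2 * \<rho>\<close>: the ball of
    radius \<open>\<rho>\<close> is mapped into itself, and \<open>\<rho> < 1\<close> is also the
    Lipschitz constant.\<close>
  define \<rho> where "\<rho> = 1 - sqrt (1 - r)"
  have r0: "0 \<le> r" using r norm_ge_zero order_trans by blast
  have "sqrt (1 - r) * sqrt (1 - r) = 1 - r" using r by simp
  then have \<rho>: "0 \<le> \<rho>" "\<rho> < 1" "r + \<rho> * \<rho> = 2 * \<rho>"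
    using r0 r unfolding \<rho>_def by (simp, simp, simp add: algebra_simps)
  define S where "S = \<A> \<inter> {Y. is_adjoint Y Y} \<inter> cball 0 \<rho>"
  define f where "f Y = (1/2) *\<^sub>R (X + (Y o\<^sub>L Y))" for Y
  have "\<exists>!Y\<in>S. f Y = Y"
  proof (rule Banach_fix[OF _ _ \<rho>(1,2)])
    show "complete S"
      unfolding complete_eq_closed S_def by (intro closed_Int closed closed_self_adjoint closed_cball)
    show "S \<noteq> {}"
      using subspace_0[OF subspace] \<rho>(1) by (auto simp: S_def intro!: exI[of _ 0] is_adjoint_zero)
    show "f ` S \<subseteq> S"
    proof clarify
      fix Y assume Y: "Y \<in> S"
      have "norm (X + (Y o\<^sub>L Y)) \<le> norm X + norm (Y o\<^sub>L Y)" by (rule norm_triangle_ineq)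
      also have "norm (Y o\<^sub>L Y) \<le> norm Y * norm Y" by (rule norm_blinfun_compose)
      also have "norm Y * norm Y \<le> \<rho> * \<rho>" using Y \<rho>(1) by (intro mult_mono) (auto simp: S_def)
      finally have "norm (X + (Y o\<^sub>L Y)) \<le> 2 * \<rho>" using r \<rho>(3) by simp
      then have "norm (f Y) \<le> \<rho>" by (simp add: f_def)
      then show "f Y \<in> S"
        using Y X subspace by (auto simp: S_def f_def intro!: subspace_scale subspace_add compose
            is_adjoint_scaleR is_adjoint_add is_adjoint_compose)
    qed
    fix Y Z assume YZ: "Y \<in> S" "Z \<in> S"
    \<comment> \<open>The factorization \<open>Y Y - Z Z = Y (Y - Z) + (Y - Z) Z\<close> is valid
      without commutativity.\<close>
    have "f Y - f Z = (1/2) *\<^sub>R ((Y o\<^sub>L (Y - Z)) + ((Y - Z) o\<^sub>L Z))"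
      by (simp add: f_def blinfun_compose_linear flip: scaleR_diff_right)
    then have "dist (f Y) (f Z) = (1/2) * norm ((Y o\<^sub>L (Y - Z)) + ((Y - Z) o\<^sub>L Z))"
      by (simp add: dist_norm)
    also have "\<dots> \<le> (1/2) * (norm Y * norm (Y - Z) + norm (Y - Z) * norm Z)"
      by (intro mult_left_mono norm_triangle_mono norm_blinfun_compose) auto
    also have "\<dots> \<le> (1/2) * (\<rho> * norm (Y - Z) + norm (Y - Z) * \<rho>)"
      using YZ by (intro mult_left_mono add_mono mult_mono) (auto simp: S_def \<rho>)
    finally show "dist (f Y) (f Z) \<le> \<rho> * dist Y Z" by (simp add: dist_norm)
  qed
  then obtain Y where Y: "Y \<in> S" "f Y = Y" by blast
  have 2: "X + (Y o\<^sub>L Y) = Y + Y"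
  proof -
    have "2 *\<^sub>R f Y = X + (Y o\<^sub>L Y)" by (simp add: f_def)
    then show ?thesis by (simp add: Y(2) scaleR_2)
  qed
  show thesis
  proof (rule that[of Y])
    have "Y \<in> \<A>" using Y by (simp add: S_def)
    then have "(E - Y) o\<^sub>L (E - Y) = E - (Y + Y) + (Y o\<^sub>L Y)"
      by (simp add: blinfun_compose_linear unit_left unit_right unit)
    then show "(E - Y) o\<^sub>L (E - Y) = E - X" by (simp flip: 2)
    show "norm Y < 1" using Y \<rho> by (simp add: S_def)
  qed (use Y in \<open>auto simp: S_def\<close>)
qed

text \<open>The fixed point of \<open>Z \<mapsto> E + Y Z\<close> is the sum of the Neumann
  series.\<close>

lemma right_inverse_exists:
  assumes Y: "Y \<in> \<A>" "norm Y < 1"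
  obtains Z where "Z \<in> \<A>" "(E - Y) o\<^sub>L Z = E"
proof -
  have "\<exists>!Z\<in>\<A>. E + (Y o\<^sub>L Z) = Z"
  proof (rule Banach_fix[OF _ _ norm_ge_zero Y(2)])
    show "complete \<A>" by (simp add: complete_eq_closed closed)
    show "\<A> \<noteq> {}" using unit by blast
    show "(\<lambda>Z. E + (Y o\<^sub>L Z)) ` \<A> \<subseteq> \<A>"
      by (auto intro!: subspace_add[OF subspace] compose unit Y)
    fix Z Z'
    show "dist (E + (Y o\<^sub>L Z)) (E + (Y o\<^sub>L Z')) \<le> norm Y * dist Z Z'"
      using norm_blinfun_compose[of Y "Z - Z'"] by (simp add: dist_norm blinfun_compose_linear)
  qed
  then obtain Z where Z: "Z \<in> \<A>" "E + (Y o\<^sub>L Z) = Z" by blast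
  have "(E - Y) o\<^sub>L Z = Z - (Y o\<^sub>L Z)" by (simp add: blinfun_compose_linear unit_left Z)
  also have "\<dots> = E" by (metis Z(2) add_diff_cancel_right')
  finally show thesis using that Z by blast
qed

text \<open>Moving \<open>R\<close> across the inner product of \<open>Z x\<close> and
  \<open>Z y\<close> shows that \<open>Z\<close> is self-adjoint; taking adjoints in
  \<open>R Z = E\<close> then makes it a left inverse too.\<close>

lemma inverse_self_adjoint:
  assumes R: "is_adjoint R R" and Z: "Z \<in> \<A>" and RZ: "R o\<^sub>L Z = E"
  shows "is_adjoint Z Z" "Z o\<^sub>L R = E"
proof -
  have E: "R (Z x) = E x" "E (Z x) = Z x" for x
    using RZ unit_left[OF Z] by (metis blinfun_apply_blinfun_compose)+
  have "inner (Z x) y = inner x (Z y)" for x y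
  proof -
    have "inner (Z x) y = inner (Z x) (E y)"
      by (metis E(2) is_adjointD[OF unit_adjoint])
    also have "\<dots> = inner (E x) (Z y)"
      using is_adjointD[OF R, of "Z x" "Z y"] by (simp add: E)
    also have "\<dots> = inner x (Z y)"
      by (simp add: is_adjointD[OF unit_adjoint] E)
    finally show ?thesis .
  qed
  then show Z': "is_adjoint Z Z" by (simp add: is_adjoint_def)
  have "is_adjoint E (Z o\<^sub>L R)" using is_adjoint_compose[OF R Z'] by (simp add: RZ)
  then show "Z o\<^sub>L R = E" using unit_adjoint is_adjoint_unique by blast
qed

text \<open>A small step of gradient descent for a coercive operator is a strict contraction; this
  makes a positive multiple of the operator invertible by a perturbation of the unit without
  appealing to positivity or polarization.\<close>

lemma norm_unit_minus_less_one:
  assumes L: "L \<in> \<A>" and c: "0 < c" "\<And>x. c * (norm (E x))\<^sup>2 \<le> inner (L x) x"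
  obtains \<tau> r where "\<tau> > 0" "r < 1" "norm (E - \<tau> *\<^sub>R L) \<le> r"
proof -
  define K where "K = norm L + 1"
  have K: "K > 0" "norm L \<le> K" by (auto simp: K_def add_nonneg_pos)
  \<comment> \<open>This step size minimises the bound
    \<open>1 - 2 * \<tau> * c + \<tau>\<^sup>2 * K\<^sup>2\<close> for the squared contraction
    factor, with minimum \<open>1 - c\<^sup>2 / K\<^sup>2\<close>.\<close>
  define \<tau> where "\<tau> = c / K\<^sup>2"
  \<comment> \<open>The maximum with zero keeps the radicand nonnegative: if \<open>E\<close>
    vanishes, \<open>c\<close> may exceed \<open>K\<close>.\<close>
  define q where "q = max 0 (1 - c\<^sup>2 / K\<^sup>2)"
  have q: "0 \<le> q" "q < 1" using c K by (auto simp: q_def)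
  have \<tau>: "\<tau> > 0" "\<tau>\<^sup>2 * K\<^sup>2 = \<tau> * c" "\<tau> * c = c\<^sup>2 / K\<^sup>2"
    using c K by (auto simp: \<tau>_def power2_eq_square field_simps)
  have "norm ((E - \<tau> *\<^sub>R L) x) \<le> sqrt q * norm x" for x
  proof -
    let ?x = "E x"
    have EE: "E ?x = ?x" "L ?x = L x"
      using unit_left[OF unit] unit_right[OF L] by (metis blinfun_apply_blinfun_compose)+
    have "(norm (?x - \<tau> *\<^sub>R L ?x))\<^sup>2
        = (norm ?x)\<^sup>2 - 2 * \<tau> * inner (L ?x) ?x + \<tau>\<^sup>2 * (norm (L ?x))\<^sup>2"
      unfolding power2_norm_eq_inner
      by (simp add: inner_diff_left inner_diff_right inner_commute power2_eq_square[of \<tau>] algebra_simps)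
    also have "\<dots> \<le> (norm ?x)\<^sup>2 - 2 * \<tau> * (c * (norm ?x)\<^sup>2) + \<tau>\<^sup>2 * (K * norm ?x)\<^sup>2"
    proof (intro add_mono diff_mono mult_left_mono power_mono)
      show "c * (norm ?x)\<^sup>2 \<le> inner (L ?x) ?x" using c(2)[of ?x] by (simp add: EE)
      show "norm (L ?x) \<le> K * norm ?x"
        using norm_blinfun[of L ?x] K(2) by (meson mult_right_mono norm_ge_zero order_trans)
    qed (use \<tau> in auto)
    also have "\<dots> = (1 - c\<^sup>2 / K\<^sup>2) * (norm ?x)\<^sup>2"
      unfolding power_mult_distrib \<tau>(3)[symmetric] using \<tau>(2)
      by (simp add: algebra_simps flip: mult.assoc)
    also have "\<dots> \<le> q * (norm ?x)\<^sup>2" by (intro mult_right_mono) (auto simp: q_def)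
    also have "\<dots> \<le> q * (norm x)\<^sup>2"
      by (intro mult_left_mono power_mono norm_unit_le q) auto
    finally have "norm (?x - \<tau> *\<^sub>R L ?x) \<le> sqrt (q * (norm x)\<^sup>2)" by (rule real_le_rsqrt)
    then show ?thesis by (simp add: real_sqrt_mult blinfun_linear EE)
  qed
  then have "norm (E - \<tau> *\<^sub>R L) \<le> sqrt q"
    by (intro norm_blinfun_bound) (auto simp: q)
  with \<tau>(1) q show thesis by (intro that[of \<tau> "sqrt q"]) auto
qed

text \<open>After rescaling, \<open>\<tau> L = (E - Y) (E - Y)\<close> with \<open>Y\<close> of norm
  below one; the inverse of \<open>E - Y\<close> times \<open>sqrt \<tau>\<close> is the required
  operator.\<close>

proposition inverse_sqrt_exists:
  assumes L: "L \<in> \<A>" "is_adjoint L L" and c: "0 < c" "\<And>x. c * (norm (E x))\<^sup>2 \<le> inner (L x) x"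
  obtains Z where "Z \<in> \<A>" "is_adjoint Z Z" "Z o\<^sub>L (L o\<^sub>L Z) = E" "L o\<^sub>L (Z o\<^sub>L Z) = E"
proof -
  obtain \<tau> r where \<tau>: "\<tau> > 0" "r < 1" "norm (E - \<tau> *\<^sub>R L) \<le> r"
    using norm_unit_minus_less_one[OF L(1) c] by blast
  have "E - \<tau> *\<^sub>R L \<in> \<A>" "is_adjoint (E - \<tau> *\<^sub>R L) (E - \<tau> *\<^sub>R L)"
    by (auto intro!: subspace_diff subspace_scale subspace unit L is_adjoint_diff is_adjoint_scaleR unit_adjoint)
  from sqrt_exists[OF this \<tau>(3,2)] obtain Y where
    Y: "Y \<in> \<A>" "is_adjoint Y Y" "norm Y < 1" "(E - Y) o\<^sub>L (E - Y) = \<tau> *\<^sub>R L" by auto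
  from right_inverse_exists[OF Y(1,3)] obtain Z where Z: "Z \<in> \<A>" "(E - Y) o\<^sub>L Z = E" by blast
  have "is_adjoint (E - Y) (E - Y)" by (intro is_adjoint_diff unit_adjoint Y)
  note Z' = inverse_self_adjoint[OF this Z]
  have ap: "(E - Y) (Z x) = E x" "Z ((E - Y) x) = E x" "\<tau> *\<^sub>R L x = (E - Y) ((E - Y) x)" "E (Z x) = Z x"
    "(E - Y) (E x) = (E - Y) x" for x
  proof -
    have EY: "(E - Y) o\<^sub>L E = E - Y" by (intro unit_right subspace_diff subspace unit Y)
    show "(E - Y) (Z x) = E x" by (metis Z(2) blinfun_apply_blinfun_compose)
    show "Z ((E - Y) x) = E x" by (metis Z'(2) blinfun_apply_blinfun_compose)
    show "\<tau> *\<^sub>R L x = (E - Y) ((E - Y) x)" by (metis Y(4) blinfun_apply_blinfun_compose blinfun.scaleR_left)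
    show "E (Z x) = Z x" by (metis unit_left[OF Z(1)] blinfun_apply_blinfun_compose)
    show "(E - Y) (E x) = (E - Y) x" by (metis EY blinfun_apply_blinfun_compose)
  qed
  define W where "W = sqrt \<tau> *\<^sub>R Z"
  show thesis
  proof (rule that[of W])
    show "W \<in> \<A>" "is_adjoint W W"
      by (auto simp: W_def intro!: subspace_scale subspace Z is_adjoint_scaleR Z')
    have tt: "sqrt \<tau> *\<^sub>R sqrt \<tau> *\<^sub>R y = \<tau> *\<^sub>R y" for y :: 'a using \<tau>(1) by simp
    show "W o\<^sub>L (L o\<^sub>L W) = E"
    proof (rule blinfun_eqI)
      fix x
      have "(W o\<^sub>L (L o\<^sub>L W)) x = sqrt \<tau> *\<^sub>R sqrt \<tau> *\<^sub>R Z (L (Z x))"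
        by (simp only: W_def blinfun_linear blinfun_apply_blinfun_compose)
      also have "\<dots> = Z (\<tau> *\<^sub>R L (Z x))" by (simp only: tt blinfun_linear)
      also have "\<dots> = E x" by (simp only: ap)
      finally show "(W o\<^sub>L (L o\<^sub>L W)) x = E x" .
    qed
    show "L o\<^sub>L (W o\<^sub>L W) = E"
    proof (rule blinfun_eqI)
      fix x
      have "(L o\<^sub>L (W o\<^sub>L W)) x = sqrt \<tau> *\<^sub>R sqrt \<tau> *\<^sub>R L (Z (Z x))"
        by (simp only: W_def blinfun_linear blinfun_apply_blinfun_compose)
      also have "\<dots> = \<tau> *\<^sub>R L (Z (Z x))" by (simp only: tt)
      also have "\<dots> = E x" by (simp only: ap)
      finally show "(L o\<^sub>L (W o\<^sub>L W)) x = E x" .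
    qed
  qed
qed

end

section \<open>The spectral gap\<close>

context cyclic_free_product
begin

text \<open>A set of representatives for the orbits of left multiplication by the cyclic factor
  \<open>b\<close> on the group.\<close>

definition not_starting :: "bool \<Rightarrow> word set" where
  "not_starting b = {y. red y \<and> (y = [] \<or> fst (hd y) \<noteq> b)}"

lemma mul1_not_starting:
  assumes "y \<in> not_starting b" "i < ord b"
  shows "mul1 (b, i) y = prepend b i y"
  using mul1_prepend[of y b i 0] assms by (auto simp: not_starting_def prepend_def)

lemma prepend_inj:
  "inj_on (\<lambda>(i, y). prepend b i y) ({..<ord b} \<times> not_starting b)"
  by (rule inj_onI) (auto simp: prepend_def not_starting_def split: if_splits)

lemma sum_translates_le:
  assumes F: "finite F" "F \<subseteq> not_starting b"
  shows "(\<Sum>y\<in>F. \<Sum>i<ord b. (cmod (Rep_ell2 x (a, mul1 (b, i) y)))\<^sup>2) \<le> (norm x)\<^sup>2"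
proof -
  let ?\<phi> = "\<lambda>(i, y). (a, prepend b i y)"
  have inj: "inj_on ?\<phi> ({..<ord b} \<times> F)"
    using inj_on_subset[OF prepend_inj, of "{..<ord b} \<times> F" b] F(2)
    by (auto simp: inj_on_def)
  have "(\<Sum>y\<in>F. \<Sum>i<ord b. (cmod (Rep_ell2 x (a, mul1 (b, i) y)))\<^sup>2)
      = (\<Sum>y\<in>F. \<Sum>i<ord b. (cmod (Rep_ell2 x (a, prepend b i y)))\<^sup>2)"
    using F(2) by (intro sum.cong) (auto simp: mul1_not_starting subsetD)
  also have "\<dots> = (\<Sum>p\<in>{..<ord b} \<times> F. (cmod (Rep_ell2 x (?\<phi> p)))\<^sup>2)"
    by (subst sum.swap) (simp add: sum.cartesian_product case_prod_unfold)
  also have "\<dots> = (\<Sum>q\<in>?\<phi> ` ({..<ord b} \<times> F). (cmod (Rep_ell2 x q))\<^sup>2)"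
    by (simp add: sum.reindex[OF inj])
  also have "\<dots> \<le> (norm x)\<^sup>2" using F by (intro sum_cmod_le_norm_ell2) auto
  finally show ?thesis .
qed

definition gen :: "bool \<Rightarrow> word" where
  "gen b = [(b, 1)]"

lemma red_gen [simp]: "red (gen b)"
  using ord_ge[of b] by (simp add: gen_def red_Cons)

text \<open>One entry of \<open>d0\<close>, namely \<open>1 - s^{-1}\<close> or
  \<open>1 - t^{-1}\<close>. Because of the inverse it compares the values at \<open>y\<close> and
  at the left translate of \<open>y\<close> by the generator.\<close>

definition diff_op :: "bool \<Rightarrow> l2op" where
  "diff_op b = U 0 0 [] - U 0 0 (inverse_word (gen b))"

lemma diff_op_apply:
  "Rep_ell2 (diff_op b x) (0, y) = (if red y then Rep_ell2 x (0, y) - Rep_ell2 x (0, mul1 (b, 1) y) else 0)"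
  by (auto simp: diff_op_def blinfun.diff_left minus_ell2.rep_eq U_apply red_inverse inverse_inverse)
    (simp add: gen_def)

lemma telescope:
  assumes "red y"
  shows "Rep_ell2 x (0, y) = Rep_ell2 x (0, mul1 (b, i) y) + (\<Sum>j<i. Rep_ell2 (diff_op b x) (0, mul1 (b, j) y))"
proof (induction i)
  case 0
  then show ?case by (simp add: mul1_mod_zero)
next
  case (Suc i)
  have "Rep_ell2 (diff_op b x) (0, mul1 (b, i) y)
      = Rep_ell2 x (0, mul1 (b, i) y) - Rep_ell2 x (0, mul1 (b, Suc i) y)"
    by (simp add: diff_op_apply red_mul1 assms mul1_mul1)
  with Suc show ?case by simp
qed

lemma cmod_sum_sq_le: "(cmod (\<Sum>j\<in>I. f j))\<^sup>2 \<le> real (card I) * (\<Sum>j\<in>I. (cmod (f j))\<^sup>2)"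
proof -
  have "(cmod (\<Sum>j\<in>I. f j))\<^sup>2 \<le> (\<Sum>j\<in>I. cmod (f j))\<^sup>2"
    by (intro power_mono norm_sum) auto
  also have "\<dots> \<le> real (card I) * (\<Sum>j\<in>I. (cmod (f j))\<^sup>2)"
    using sum_squared_le_sum_of_squares[of "\<lambda>j. cmod (f j)" I] by (simp add: mult.commute)
  finally show ?thesis .
qed

text \<open>The cross term is split unevenly by \<open>(u - 10 v)\<^sup>2 \<ge> 0\<close>. The
  factor \<open>11/10\<close> is close enough to 1 to survive multiplication by \<open>5/6\<close>
  in the spectral gap.\<close>

lemma cmod_add_sq_le: "(cmod (u + v))\<^sup>2 \<le> 11/10 * (cmod u)\<^sup>2 + 11 * (cmod v)\<^sup>2"
proof -
  have "(cmod (u + v))\<^sup>2 \<le> (cmod u + cmod v)\<^sup>2"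
    by (intro power_mono norm_triangle_ineq) auto
  also have "\<dots> \<le> 11/10 * (cmod u)\<^sup>2 + 11 * (cmod v)\<^sup>2"
    using zero_le_power2[of "cmod u - 10 * cmod v"] by (simp add: power2_eq_square algebra_simps)
  finally show ?thesis .
qed

text \<open>The words not starting with a letter from the factor \<open>b\<close> have \<open>ord b\<close> disjoint
  translates, so a vector which is nearly invariant under this factor has at most about
  a fraction \<open>1 / ord b\<close> of its mass there.\<close>

lemma sum_not_starting_le:
  assumes F: "finite F" "F \<subseteq> not_starting b"
  shows "(\<Sum>y\<in>F. (cmod (Rep_ell2 x (0, y)))\<^sup>2)
    \<le> 11/10 * (norm (U 0 0 [] x))\<^sup>2 / real (ord b) + 11 * real (ord b) * (norm (diff_op b x))\<^sup>2"
proof -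
  let ?r = "ord b" and ?d = "diff_op b x"
  let ?x = "\<lambda>i y. (cmod (Rep_ell2 x (0, mul1 (b, i) y)))\<^sup>2"
  let ?y = "\<lambda>i y. (cmod (Rep_ell2 ?d (0, mul1 (b, i) y)))\<^sup>2"
  have 1: "(cmod (Rep_ell2 x (0, y)))\<^sup>2 \<le> 11/10 * ?x i y + 11 * real ?r * (\<Sum>j<?r. ?y j y)"
    if "y \<in> F" "i < ?r" for i y
  proof -
    have "red y" using that F by (auto simp: not_starting_def)
    have "(cmod (Rep_ell2 x (0, y)))\<^sup>2
        \<le> 11/10 * ?x i y + 11 * (cmod (\<Sum>j<i. Rep_ell2 ?d (0, mul1 (b, j) y)))\<^sup>2"
      unfolding telescope[OF \<open>red y\<close>, of x b i] by (rule cmod_add_sq_le)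
    also have "(cmod (\<Sum>j<i. Rep_ell2 ?d (0, mul1 (b, j) y)))\<^sup>2 \<le> real i * (\<Sum>j<i. ?y j y)"
      using cmod_sum_sq_le[of "\<lambda>j. Rep_ell2 ?d (0, mul1 (b, j) y)" "{..<i}"] by simp
    also have "\<dots> \<le> real ?r * (\<Sum>j<?r. ?y j y)"
      using that by (intro mult_mono sum_mono2 sum_nonneg) auto
    finally show ?thesis by simp
  qed
  \<comment> \<open>Averaging over all \<open>ord b\<close> translates: each sum of translates is
    bounded by one full squared norm, which yields the factor \<open>1 / ord b\<close>.\<close>
  have "real ?r * (\<Sum>y\<in>F. (cmod (Rep_ell2 x (0, y)))\<^sup>2)
      = (\<Sum>y\<in>F. \<Sum>i<?r. (cmod (Rep_ell2 x (0, y)))\<^sup>2)"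
    by (simp add: sum_distrib_left)
  also have "\<dots> \<le> (\<Sum>y\<in>F. \<Sum>i<?r. 11/10 * ?x i y + 11 * real ?r * (\<Sum>j<?r. ?y j y))"
    by (intro sum_mono 1) auto
  also have "\<dots> = 11/10 * (\<Sum>y\<in>F. \<Sum>i<?r. ?x i y) + 11 * real ?r * (real ?r * (\<Sum>y\<in>F. \<Sum>j<?r. ?y j y))"
    by (simp add: sum.distrib sum_distrib_left algebra_simps)
  also have "\<dots> \<le> 11/10 * (norm (U 0 0 [] x))\<^sup>2 + 11 * real ?r * (real ?r * (norm ?d)\<^sup>2)"
  proof (intro add_mono mult_left_mono)
    have "(\<Sum>y\<in>F. \<Sum>i<?r. ?x i y)
        = (\<Sum>y\<in>F. \<Sum>i<?r. (cmod (Rep_ell2 (U 0 0 [] x) (0, mul1 (b, i) y)))\<^sup>2)"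
      using F by (intro sum.cong) (auto simp: U_apply red_mul1 not_starting_def)
    then show "(\<Sum>y\<in>F. \<Sum>i<?r. ?x i y) \<le> (norm (U 0 0 [] x))\<^sup>2"
      using sum_translates_le[OF F] by simp
    show "(\<Sum>y\<in>F. \<Sum>j<?r. ?y j y) \<le> (norm ?d)\<^sup>2" by (rule sum_translates_le[OF F])
  qed auto
  finally show ?thesis using ord_pos[of b] by (simp add: field_simps)
qed

text \<open>Since \<open>1/m + 1/n \<le> 5/6 < 1\<close>, no vector can be nearly invariant under both factors.\<close>

lemma spectral_gap:
  "(norm (U 0 0 [] x))\<^sup>2 \<le> 132 * real (m + n) * ((norm (diff_op False x))\<^sup>2 + (norm (diff_op True x))\<^sup>2)"
proof -
  let ?N = "(norm (U 0 0 [] x))\<^sup>2" and ?s = "(norm (diff_op False x))\<^sup>2" and ?t = "(norm (diff_op True x))\<^sup>2"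
  \<comment> \<open>Here \<open>11/12 = 11/10 * (1/2 + 1/3)\<close>; absorbing this part leaves
    \<open>1/12\<close> on the left, whence the constant \<open>132 = 12 * 11\<close>.\<close>
  define B where "B = 11/12 * ?N + 11 * real (m + n) * (?s + ?t)"
  have mn: "1 / real m \<le> 1 / 2" "1 / real n \<le> 1 / 3" using m_ge n_ge by (auto simp: field_simps)
  have "?N \<le> B"
  proof (rule has_sum_le_finite_sums[OF norm_sq_ell2_has_sum])
    fix F :: "(nat \<times> word) set" assume F: "finite F" "F \<subseteq> UNIV"
    define G where "G = snd ` {p\<in>F. fst p = 0 \<and> red (snd p)}"
    have G: "finite G" using F by (simp add: G_def)
    have "(\<Sum>p\<in>F. (cmod (Rep_ell2 (U 0 0 [] x) p))\<^sup>2)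
        = (\<Sum>p\<in>{p\<in>F. fst p = 0 \<and> red (snd p)}. (cmod (Rep_ell2 (U 0 0 [] x) p))\<^sup>2)"
      using F by (intro sum.mono_neutral_right) (auto simp: U_apply split: if_splits)
    also have "\<dots> = (\<Sum>y\<in>G. (cmod (Rep_ell2 x (0, y)))\<^sup>2)"
      unfolding G_def by (subst sum.reindex) (auto simp: inj_on_def U_apply intro!: sum.cong)
    \<comment> \<open>A first letter belongs to one factor only, so every reduced word avoids
      starting in at least one of the two.\<close>
    also have "\<dots> \<le> (\<Sum>y\<in>(G \<inter> not_starting False) \<union> (G \<inter> not_starting True). (cmod (Rep_ell2 x (0, y)))\<^sup>2)"
      using G by (intro sum_mono2) (auto simp: G_def not_starting_def)
    also have "\<dots> \<le> (\<Sum>y\<in>G \<inter> not_starting False. (cmod (Rep_ell2 x (0, y)))\<^sup>2)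
        + (\<Sum>y\<in>G \<inter> not_starting True. (cmod (Rep_ell2 x (0, y)))\<^sup>2)"
      using G by (subst sum.union_inter[symmetric]) (auto intro!: sum_nonneg)
    also have "\<dots> \<le> (11/10 * ?N / real (ord False) + 11 * real (ord False) * ?s) + (11/10 * ?N / real (ord True) + 11 * real (ord True) * ?t)"
      using G by (intro add_mono sum_not_starting_le) auto
    also have "\<dots> = 11/10 * ?N * (1 / real m + 1 / real n) + 11 * (real m * ?s + real n * ?t)"
      by (simp add: ord_of_def algebra_simps)
    also have "\<dots> \<le> 11/10 * ?N * (1 / 2 + 1 / 3) + 11 * (real (m + n) * ?s + real (m + n) * ?t)"
      using mn by (intro add_mono mult_left_mono mult_right_mono) auto
    also have "\<dots> = B" by (simp add: B_def algebra_simps)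
    finally show "(\<Sum>p\<in>F. (cmod (Rep_ell2 (U 0 0 [] x) p))\<^sup>2) \<le> B" .
  qed
  then show ?thesis by (simp add: B_def algebra_simps)
qed

end

section \<open>Operators on functions and bounded operators\<close>

context cyclic_free_product
begin

text \<open>The bridge from the operators of the statement to the algebra. Agreement is asked on
  \<open>comps k\<close> alone, since for instance \<open>\<lambda>f. f\<close> and its counterpart
  \<open>U 0 0 []\<close> differ elsewhere.\<close>

definition realizes :: "nat \<Rightarrow> op \<Rightarrow> l2op \<Rightarrow> bool" where
  "realizes k T A \<longleftrightarrow> A \<in> alg k \<and> (\<forall>x\<in>comps k. T (Rep_ell2 x) = Rep_ell2 (A x))"

lemma realizesD: "realizes k T A \<Longrightarrow> x \<in> comps k \<Longrightarrow> T (Rep_ell2 x) = Rep_ell2 (A x)"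
  by (simp add: realizes_def)

lemma realizes_alg: "realizes k T A \<Longrightarrow> A \<in> alg k"
  by (simp add: realizes_def)

lemma comps_add: "x \<in> comps k \<Longrightarrow> y \<in> comps k \<Longrightarrow> x + y \<in> comps k"
  by (simp add: comps_def blinfun.add_right)

lemma comps_diff: "x \<in> comps k \<Longrightarrow> y \<in> comps k \<Longrightarrow> x - y \<in> comps k"
  by (simp add: comps_def blinfun.diff_right)

lemma comps_scaleR: "x \<in> comps k \<Longrightarrow> r *\<^sub>R x \<in> comps k"
  by (simp add: comps_def blinfun.scaleR_right)

lemma comps_mult_i: "x \<in> comps k \<Longrightarrow> mult_i x \<in> comps k"
  by (simp add: comps_def alg_mult_i[OF one_mat_in_alg])

lemma comps_zero: "0 \<in> comps k"
  by (simp add: comps_def blinfun.zero_right)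

text \<open>Reduces complex homogeneity to real linearity and commutation with
  \<open>mult_i\<close>.\<close>

lemma Rep_cmult: "(\<lambda>p. c * Rep_ell2 x p) = Rep_ell2 (Re c *\<^sub>R x + Im c *\<^sub>R mult_i x)"
  by (rule ext) (simp add: plus_ell2.rep_eq scaleR_ell2.rep_eq mult_i.rep_eq complex_eq_iff)

lemma cinner_adjoint:
  assumes "is_adjoint A B" "B \<in> alg k"
  shows "cinner (A x) y = cinner x (B y)"
  by (simp add: cinner_eq_inner is_adjointD[OF assms(1)] alg_mult_i[OF assms(2)])

lemma bounded_op_realizes:
  assumes "realizes k T A"
  shows "bounded_op m n k k T"
  unfolding bounded_op_def
proof (intro conjI ballI allI)
  note T = realizesD[OF assms] and A = realizes_alg[OF assms]
  fix f g c assume "f \<in> l2space m n k" "g \<in> l2space m n k"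
  then obtain x y where f: "f = Rep_ell2 x" "x \<in> comps k" and g: "g = Rep_ell2 y" "y \<in> comps k"
    using l2spaceE by metis
  have fg: "(\<lambda>p. f p + g p) = Rep_ell2 (x + y)" by (simp add: f g plus_ell2.rep_eq)
  show "T (\<lambda>p. f p + g p) = (\<lambda>p. T f p + T g p)"
    unfolding fg T[OF comps_add[OF f(2) g(2)]] by (simp add: f g T blinfun.add_right plus_ell2.rep_eq)
next
  note T = realizesD[OF assms] and A = realizes_alg[OF assms]
  fix f c assume "f \<in> l2space m n k"
  then obtain x where f: "f = Rep_ell2 x" "x \<in> comps k" using l2spaceE by metis
  show "T f \<in> l2space m n k" by (simp add: f T Rep_in_l2space alg_in_comps[OF A])
  show "T (\<lambda>p. c * f p) = (\<lambda>p. c * T f p)"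
    by (simp add: f T Rep_cmult comps_add comps_scaleR comps_mult_i blinfun.add_right
        blinfun.scaleR_right alg_mult_i[OF A])
next
  show "\<exists>C. \<forall>f\<in>l2space m n k. l2norm (T f) \<le> C * l2norm f"
  proof (intro exI ballI)
    fix f assume "f \<in> l2space m n k"
    then obtain x where f: "f = Rep_ell2 x" "x \<in> comps k" using l2spaceE by metis
    show "l2norm (T f) \<le> norm A * l2norm f"
      by (simp add: f realizesD[OF assms] l2norm_Rep norm_blinfun)
  qed
qed

lemma span_gens_expansion:
  assumes "B \<in> span (gens k)"
  obtains F and c :: "nat \<times> nat \<times> word \<Rightarrow> real" where
    "finite F" "F \<subseteq> {..<k} \<times> {..<k} \<times> Collect red" "B = (\<Sum>(i,j,g)\<in>F. c (i,j,g) *\<^sub>R U i j g)"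
proof -
  obtain t r where t: "finite t" "t \<subseteq> gens k" "B = (\<Sum>a\<in>t. r a *\<^sub>R a)"
    using assms unfolding span_explicit by blast
  let ?U = "\<lambda>(i, j, g). U i j g"
  let ?I = "{..<k} \<times> {..<k} \<times> Collect red"
  have "t \<subseteq> ?U ` ?I" using t(2) unfolding gens_def by force
  \<comment> \<open>The span is a sum over operators while \<open>cstar_mat\<close> sums over index
    triples; a subset of triples on which \<open>?U\<close> is injective translates one into the
    other.\<close>
  then obtain F where F: "F \<subseteq> ?I" "inj_on ?U F" "t = ?U ` F"
    using subset_image_inj[of t ?U ?I] by auto
  have "finite F" using t(1) F finite_imageD by blast
  moreover have "B = (\<Sum>(i,j,g)\<in>F. r (U i j g) *\<^sub>R U i j g)"
    unfolding t(3) F(3) by (subst sum.reindex[OF F(2)]) (simp add: case_prod_unfold)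
  ultimately show thesis
    using that[of F "\<lambda>(i,j,g). r (U i j g)"] F(1) by (simp add: case_prod_unfold)
qed

lemma cstar_mat_realizes:
  assumes "realizes k T A"
  shows "cstar_mat m n k T"
  unfolding cstar_mat_def
proof (intro conjI allI impI)
  show "bounded_op m n k k T" by (rule bounded_op_realizes[OF assms])
  fix \<epsilon> :: real assume "\<epsilon> > 0"
  then obtain B where B: "B \<in> span (gens k)" "dist B A < \<epsilon>"
    using realizes_alg[OF assms] unfolding alg_def closure_approachable by blast
  obtain F and c :: "nat \<times> nat \<times> word \<Rightarrow> real" where
    F: "finite F" "F \<subseteq> {..<k} \<times> {..<k} \<times> Collect red" "B = (\<Sum>(i,j,g)\<in>F. c (i,j,g) *\<^sub>R U i j g)"
    using span_gens_expansion[OF B(1)] by blast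
  let ?D = "\<lambda>f p. T f p - (\<Sum>(i,j,g)\<in>F. complex_of_real (c (i,j,g)) * elem_op m n i j g f p)"
  have D: "?D (Rep_ell2 x) = Rep_ell2 ((A - B) x)" if "x \<in> comps k" for x
  proof (rule ext)
    fix p
    have "Rep_ell2 (B x) p = (\<Sum>q\<in>F. Rep_ell2 ((case q of (i,j,g) \<Rightarrow> c (i,j,g) *\<^sub>R U i j g) x) p)"
      unfolding F(3) by (simp add: blinfun.sum_left Rep_sum)
    also have "\<dots> = (\<Sum>(i,j,g)\<in>F. complex_of_real (c (i,j,g)) * elem_op m n i j g (Rep_ell2 x) p)"
      using F(2) by (intro sum.cong) (auto simp: blinfun.scaleR_left scaleR_ell2.rep_eq Rep_U)
    finally show "?D (Rep_ell2 x) p = Rep_ell2 ((A - B) x) p"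
      by (simp add: realizesD[OF assms that] blinfun.diff_left minus_ell2.rep_eq)
  qed
  have "opnorm m n k ?D \<le> \<epsilon>"
    unfolding opnorm_def
  proof (rule cSup_least)
    \<comment> \<open>The zero vector witnesses that the supremum is over a nonempty set.\<close>
    show "{l2norm (?D f) |f. f \<in> l2space m n k \<and> l2norm f \<le> 1} \<noteq> {}"
      using Rep_in_l2space[of 0 k] comps_zero[of k] l2norm_Rep[of 0] by fastforce
    fix r assume "r \<in> {l2norm (?D f) |f. f \<in> l2space m n k \<and> l2norm f \<le> 1}"
    then obtain f where r: "r = l2norm (?D f)" and f: "f \<in> l2space m n k" "l2norm f \<le> 1" by blast
    obtain x where x: "f = Rep_ell2 x" "x \<in> comps k" using f(1) l2spaceE by metis
    have "r = norm ((A - B) x)" unfolding r x(1) D[OF x(2)] by (rule l2norm_Rep)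
    also have "\<dots> \<le> norm (A - B) * norm x" by (rule norm_blinfun)
    also have "\<dots> \<le> norm (A - B) * 1" using f x by (intro mult_left_mono) (auto simp: l2norm_Rep)
    also have "\<dots> \<le> \<epsilon>" using B(2) by (simp add: dist_norm norm_minus_commute)
    finally show "r \<le> \<epsilon>" .
  qed
  then show "\<exists>F c. finite F \<and> F \<subseteq> {..<k} \<times> {..<k} \<times> Collect red \<and>
      opnorm m n k (\<lambda>f p. T f p - (\<Sum>(i,j,g)\<in>F. c (i,j,g) * elem_op m n i j g f p)) \<le> \<epsilon>"
    using F(1,2) by (intro exI[of _ F] exI[of _ "\<lambda>q. complex_of_real (c q)"]) simp
qed

lemma is_adj_realizes:
  assumes "realizes k T A" "realizes k S B" "is_adjoint A B"
  shows "is_adj m n k k T S"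
  unfolding is_adj_def
proof (intro ballI)
  fix f g assume "f \<in> l2space m n k" "g \<in> l2space m n k"
  then obtain x y where f: "f = Rep_ell2 x" "x \<in> comps k" and g: "g = Rep_ell2 y" "y \<in> comps k"
    using l2spaceE by metis
  then show "l2inner (T f) g = l2inner f (S g)"
    by (simp add: realizesD[OF assms(1)] realizesD[OF assms(2)] l2inner_Rep
        cinner_adjoint[OF assms(3) realizes_alg[OF assms(2)]])
qed

lemma cstar_proj_realizes:
  assumes T: "realizes k T A" and A: "is_adjoint A A" "\<And>x. A (A x) = A x"
  shows "cstar_proj m n k T"
proof -
  have "T (T f) = T f" if "f \<in> l2space m n k" for f
    using that by (auto elim!: l2spaceE simp: realizesD[OF T] alg_in_comps[OF realizes_alg[OF T]] A)
  then show ?thesis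
    unfolding cstar_proj_def using cstar_mat_realizes[OF T] is_adj_realizes[OF T T A(1)] by blast
qed

lemma mvn_realizes:
  assumes P: "realizes k P A" and Q: "realizes k Q B"
    and V: "V \<in> alg k" "W \<in> alg k" "is_adjoint V W"
    and WV: "\<And>x. W (V x) = A x" and VW: "\<And>x. V (W x) = B x"
  shows "mvn m n k P Q"
proof -
  \<comment> \<open>Carries the abstract partial isometry and its adjoint back to operators on
    functions, as \<open>mvn\<close> requires.\<close>
  define lift where "lift C f = Rep_ell2 (blinfun_apply C (Abs_ell2 f))" for C :: l2op and f
  have lift: "realizes k (lift C) C" if "C \<in> alg k" for C
    using that by (simp add: realizes_def lift_def Rep_ell2_inverse)
  note lV = lift[OF V(1)] and lW = lift[OF V(2)]
  show ?thesis
    unfolding mvn_def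
  proof (intro exI conjI ballI)
    show "cstar_mat m n k (lift V)" "cstar_mat m n k (lift W)"
      using lV lW cstar_mat_realizes by blast+
    show "is_adj m n k k (lift V) (lift W)" by (rule is_adj_realizes[OF lV lW V(3)])
    fix f assume "f \<in> l2space m n k"
    then obtain x where x: "f = Rep_ell2 x" "x \<in> comps k" using l2spaceE by metis
    show "lift W (lift V f) = P f"
      by (simp add: x realizesD[OF lV] realizesD[OF lW] alg_in_comps V WV realizesD[OF P])
    show "lift V (lift W f) = Q f"
      by (simp add: x realizesD[OF lV] realizesD[OF lW] alg_in_comps V VW realizesD[OF Q])
  qed
qed

text \<open>Evaluates the description in \<open>adj\<close>: a competing representing vector is
  excluded by testing against its difference from \<open>B y\<close>.\<close>

lemma adj_eq:
  fixes A B :: l2op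
  assumes T: "\<And>x. x \<in> comps k \<Longrightarrow> T (Rep_ell2 x) = Rep_ell2 (A x)"
    and A: "is_adjoint A B" "B \<in> alg l" and y: "y \<in> comps j" "B y \<in> comps k"
  shows "adj m n k j T (Rep_ell2 y) = Rep_ell2 (B y)"
proof -
  have "(THE h. h \<in> l2space m n k \<and> (\<forall>f\<in>l2space m n k. l2inner (T f) (Rep_ell2 y) = l2inner f h))
      = Rep_ell2 (B y)"
  proof (rule the_equality)
    show "Rep_ell2 (B y) \<in> l2space m n k \<and>
        (\<forall>f\<in>l2space m n k. l2inner (T f) (Rep_ell2 y) = l2inner f (Rep_ell2 (B y)))"
      using y by (auto simp: Rep_in_l2space T l2inner_Rep cinner_adjoint[OF A] elim!: l2spaceE)
    fix h assume h: "h \<in> l2space m n k \<and> (\<forall>f\<in>l2space m n k. l2inner (T f) (Rep_ell2 y) = l2inner f h)"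
    then obtain z where z: "h = Rep_ell2 z" "z \<in> comps k" using l2spaceE by metis
    have "cinner x (B y) = cinner x z" if "x \<in> comps k" for x
      using h that by (metis Rep_in_l2space T cinner_adjoint[OF A] l2inner_Rep z(1))
    then have "inner x (B y) = inner x z" if "x \<in> comps k" for x
      using that by (simp add: cinner_eq_inner)
    from this[OF comps_diff[OF y(2) z(2)]] have "inner (B y - z) (B y - z) = 0"
      by (simp add: inner_diff_right)
    then show "h = Rep_ell2 (B y)" by (simp add: z)
  qed
  then show ?thesis using y by (simp add: adj_def Rep_in_l2space)
qed

text \<open>Evaluates the description in \<open>orthproj\<close>: two candidates differ by an
  element of \<open>K'\<close> to which both residuals are orthogonal, so it is orthogonal to
  itself.\<close>

lemma orthproj_eq:
  assumes K: "K = Rep_ell2 ` K'" "K' \<subseteq> comps k" "\<And>x y. x \<in> K' \<Longrightarrow> y \<in> K' \<Longrightarrow> x - y \<in> K'"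
    and x: "x \<in> comps k" and y: "y \<in> K'" "\<And>z. z \<in> K' \<Longrightarrow> cinner (x - y) z = 0"
  shows "orthproj m n k K (Rep_ell2 x) = Rep_ell2 y"
proof -
  have d: "(\<lambda>p. Rep_ell2 x p - Rep_ell2 y p) = Rep_ell2 (x - y)" for x y :: "(nat \<times> word) ell2"
    by (simp add: minus_ell2.rep_eq)
  have "(THE g. g \<in> K \<and> (\<forall>h\<in>K. l2inner (\<lambda>p. Rep_ell2 x p - g p) h = 0)) = Rep_ell2 y"
  proof (rule the_equality)
    show "Rep_ell2 y \<in> K \<and> (\<forall>h\<in>K. l2inner (\<lambda>p. Rep_ell2 x p - Rep_ell2 y p) h = 0)"
      using y by (auto simp: K(1) d l2inner_Rep)
    fix g assume g: "g \<in> K \<and> (\<forall>h\<in>K. l2inner (\<lambda>p. Rep_ell2 x p - g p) h = 0)"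
    then obtain z where z: "g = Rep_ell2 z" "z \<in> K'" by (auto simp: K(1))
    have yz: "y - z \<in> K'" using K(3) y(1) z(2) by blast
    have "cinner (x - z) (y - z) = 0" using g yz by (auto simp: K(1) z(1) d l2inner_Rep)
    then have "inner (x - z) (y - z) = 0" "inner (x - y) (y - z) = 0"
      using y(2)[OF yz] by (simp_all add: cinner_eq_inner complex_eq_iff)
    then have "inner (y - z) (y - z) = 0" by (simp add: inner_diff_left)
    then show "g = Rep_ell2 y" by (simp add: z)
  qed
  then show ?thesis using x by (simp add: orthproj_def Rep_in_l2space)
qed

section \<open>Placing blocks on the diagonal\<close>

definition shift_down :: "nat \<Rightarrow> nat \<Rightarrow> l2op" where
  "shift_down o' k = (\<Sum>b<k. U b (b + o') [])"

definition shift_up :: "nat \<Rightarrow> nat \<Rightarrow> l2op" where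
  "shift_up o' k = (\<Sum>b<k. U (b + o') b [])"

lemma shift_down_apply:
  "Rep_ell2 (shift_down o' k x) (a, y) = (if a < k \<and> red y then Rep_ell2 x (a + o', y) else 0)"
  by (auto simp: shift_down_def blinfun.sum_left Rep_sum U_apply cong: if_cong)

lemma shift_up_apply:
  "Rep_ell2 (shift_up o' k x) (a, y) = (if o' \<le> a \<and> a < o' + k \<and> red y then Rep_ell2 x (a - o', y) else 0)"
proof -
  have "Rep_ell2 (shift_up o' k x) (a, y)
      = (\<Sum>b<k. if b = a - o' then (if o' \<le> a \<and> red y then Rep_ell2 x (a - o', y) else 0) else 0)"
    unfolding shift_up_def blinfun.sum_left Rep_sum by (rule sum.cong) (auto simp: U_apply)
  then show ?thesis by (auto simp: sum.delta)
qed

lemma shift_down_comps: "shift_down o' k x \<in> comps k"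
  unfolding comps_def by (auto intro!: ell2_eqI simp: one_mat_apply shift_down_apply)

text \<open>Turns \<open>block\<close> into a composition of bounded operators, to which the matrix
  unit calculus applies.\<close>

lemma block_realizes:
  assumes T: "realizes k T A" and x: "x \<in> comps N"
  shows "block o' k T (Rep_ell2 x) = Rep_ell2 (shift_up o' k (A (shift_down o' k x)))"
proof -
  have supp: "red z" if "Rep_ell2 x (b, z) \<noteq> 0" for b z
    using x that unfolding Rep_in_l2space[symmetric] l2space_def by blast
  have "(\<lambda>(b, z). if b < k then Rep_ell2 x (b + o', z) else 0) = Rep_ell2 (shift_down o' k x)"
    using supp by (auto simp: shift_down_apply fun_eq_iff)
  moreover have "red y" if "Rep_ell2 (A (shift_down o' k x)) (b, y) \<noteq> 0" for b y
    using alg_in_comps[OF realizes_alg[OF T], of "shift_down o' k x"] that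
    unfolding Rep_in_l2space[symmetric] l2space_def by blast
  ultimately show ?thesis
    by (auto simp: block_def fun_eq_iff shift_up_apply realizesD[OF T shift_down_comps])
qed

end

section \<open>The projection onto the harmonic vectors\<close>

lemma bij_betw_add_mod:
  fixes j r :: nat
  assumes "j < r"
  shows "bij_betw (\<lambda>i. (i + j) mod r) {..<r} {..<r}"
proof (rule bij_betw_byWitness[where f' = "\<lambda>i. (i + (r - j)) mod r"])
  have "(a + j + (r - j)) mod r = a" "(a + (r - j) + j) mod r = a" if "a < r" for a
    using assms that by simp_all
  then show "\<forall>a\<in>{..<r}. ((a + j) mod r + (r - j)) mod r = a"
    "\<forall>a\<in>{..<r}. ((a + (r - j)) mod r + j) mod r = a"
    unfolding mod_add_left_eq by blast+
qed (use assms in auto)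

lemma bij_betw_neg_mod:
  fixes r :: nat
  shows "bij_betw (\<lambda>i. (r - i) mod r) {..<r} {..<r}"
proof (rule bij_betw_byWitness[where f' = "\<lambda>i. (r - i) mod r"])
  have "(r - (r - a) mod r) mod r = a" if "a < r" for a
    using that by (cases "a = 0") auto
  then show "\<forall>a\<in>{..<r}. (r - (r - a) mod r) mod r = a"
    "\<forall>a\<in>{..<r}. (r - (r - a) mod r) mod r = a" by auto
qed auto

context cyclic_free_product
begin

section \<open>The averaging projections\<close>

definition pow :: "bool \<Rightarrow> nat \<Rightarrow> word" where
  "pow b i = (if i = 0 then [] else [(b, i)])"

lemma red_pow [simp]: "i < ord b \<Longrightarrow> red (pow b i)"
  by (simp add: pow_def red_Cons)

lemma mul_pow: "i < ord b \<Longrightarrow> j < ord b \<Longrightarrow> mul (pow b i) (pow b j) = pow b ((i + j) mod ord b)"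
  by (auto simp: pow_def gmul1_def Let_def add.commute)

lemma inverse_pow: "i < ord b \<Longrightarrow> inverse_word (pow b i) = pow b ((ord b - i) mod ord b)"
  by (auto simp: pow_def ginv_def)

lemma gen_eq_pow: "gen b = pow b 1"
  by (simp add: gen_def pow_def)

definition avg :: "nat \<Rightarrow> bool \<Rightarrow> l2op" where
  "avg a b = (1 / real (ord b)) *\<^sub>R (\<Sum>i<ord b. U a a (pow b i))"

lemma avg_in_alg: "a < k \<Longrightarrow> avg a b \<in> alg k"
  unfolding avg_def by (intro alg_scaleR alg_sum U_in_alg) auto

text \<open>Multiplication by a power of the generator permutes the summands; idempotence and the
  vanishing on \<open>diff_op\<close> follow from this.\<close>

lemma avg_pow: 
  assumes "j < ord b"
  shows "avg a b o\<^sub>L U a a (pow b j) = avg a b"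
proof -
  have "avg a b o\<^sub>L U a a (pow b j) = (1 / real (ord b)) *\<^sub>R (\<Sum>i<ord b. U a a (pow b ((i + j) mod ord b)))"
    using assms by (auto simp: avg_def blinfun_compose_linear U_compose mul_pow intro!: sum.cong)
  also have "(\<Sum>i<ord b. U a a (pow b ((i + j) mod ord b))) = (\<Sum>i<ord b. U a a (pow b i))"
    by (rule sum.reindex_bij_betw[OF bij_betw_add_mod[OF assms]])
  finally show ?thesis by (simp add: avg_def)
qed

lemma avg_idem: "avg a b o\<^sub>L avg a b = avg a b"
proof -
  have "avg a b o\<^sub>L avg a b = (1 / real (ord b)) *\<^sub>R (\<Sum>i<ord b. avg a b o\<^sub>L U a a (pow b i))"
    by (subst (2) avg_def) (simp add: blinfun_compose_linear)
  also have "\<dots> = avg a b" using ord_pos[of b] by (simp add: avg_pow sum_constant_scaleR)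
  finally show ?thesis .
qed

lemma avg_adjoint: "is_adjoint (avg a b) (avg a b)"
proof -
  have "is_adjoint (avg a b) ((1 / real (ord b)) *\<^sub>R (\<Sum>i<ord b. U a a (pow b ((ord b - i) mod ord b))))"
    unfolding avg_def using U_adjoint[of "pow b _" a a]
    by (intro is_adjoint_scaleR is_adjoint_sum) (metis inverse_pow lessThan_iff red_pow)
  also have "(\<Sum>i<ord b. U a a (pow b ((ord b - i) mod ord b))) = (\<Sum>i<ord b. U a a (pow b i))"
    by (rule sum.reindex_bij_betw[OF bij_betw_neg_mod])
  finally show ?thesis by (simp add: avg_def)
qed

lemma mul_Nil_pow: "i < ord b \<Longrightarrow> mul (pow b i) [] = pow b i"
  by (auto simp: pow_def gmul1_def)

text \<open>This and the following rules give a normal form for rewriting: matrix units move inward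
  past averages, and products with mismatched components vanish.\<close>

lemma avg_unit: "avg c b o\<^sub>L U a d [] = (if a = c then U c c [] o\<^sub>L (avg c b o\<^sub>L U c d []) else 0)"
  by (auto simp: avg_def blinfun_compose_linear U_compose red_mul mul_Nil_pow intro!: sum.cong sum.neutral)

lemma unit_avg: "U a c [] o\<^sub>L avg c b = avg a b o\<^sub>L U a c []"
  by (auto simp: avg_def blinfun_compose_linear U_compose mul_Nil_pow intro!: sum.cong)

lemma unit_avg_zero: "d \<noteq> c \<Longrightarrow> U a d [] o\<^sub>L avg c b = 0"
  by (auto simp: avg_def blinfun_compose_linear U_compose)

text \<open>Keeps the component index \<open>1\<close> from turning into \<open>Suc 0\<close>, so
  that rules about \<open>U 1 0 []\<close> continue to match.\<close>

declare One_nat_def [simp del]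

lemma compose_eqD: "A o\<^sub>L B = C \<Longrightarrow> blinfun_apply A (blinfun_apply B x) = blinfun_apply C x"
  by (metis blinfun_apply_blinfun_compose)

lemma unit_unit [simp]: "U i j [] (U k l [] x) = (if j = k then U i l [] x else 0)"
  using compose_eqD[OF U_compose[of "[]" "[]" i j k l], of x] by (auto simp: blinfun.zero_left)

lemma unit_avg_apply [simp]: "U a d [] (avg c b x) = (if d = c then avg a b (U a c [] x) else 0)"
  using compose_eqD[OF unit_avg[of a c b], of x] compose_eqD[OF unit_avg_zero[of d c a b], of x]
  by (auto simp: blinfun.zero_left)

lemma avg_unit_zero [simp]: "a \<noteq> c \<Longrightarrow> avg c b (U a d [] x) = 0"
  using compose_eqD[OF avg_unit[of c b a d], of x] by (auto simp: blinfun.zero_left)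

lemma avg_idem_apply [simp]: "avg a b (avg a b x) = avg a b x"
  by (rule compose_eqD[OF avg_idem])

lemma one_mat_1: "one_mat 1 = U 0 0 []"
  by (simp add: one_mat_def One_nat_def)

lemma one_mat_2: "one_mat 2 = U 0 0 [] + U 1 1 []"
  by (simp add: one_mat_def numeral_2_eq_2 One_nat_def)

lemma avg_unit_same [simp]: "avg c b (U c c [] x) = avg c b x"
proof -
  have "avg c b o\<^sub>L U c c [] = avg c b"
    using avg_pow[of 0 b c] ord_pos[of b] by (simp add: pow_def)
  then show ?thesis by (rule compose_eqD)
qed

lemma avg_avg_zero [simp]: "a \<noteq> c \<Longrightarrow> avg a b (avg c b' x) = 0"
  using avg_unit_zero[of c a b c "avg c b' x"] by simp

section \<open>The coboundary \<open>d0\<close> and the inverse square root of its Laplacian\<close>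

definition diff_op_adj :: "bool \<Rightarrow> l2op" where
  "diff_op_adj b = U 0 0 [] - U 0 0 (gen b)"

lemma diff_op_in_alg: "diff_op b \<in> alg 1" "diff_op_adj b \<in> alg 1"
  by (auto simp: diff_op_def diff_op_adj_def red_inverse intro!: alg_diff U_in_alg)

lemma diff_op_adjoint: "is_adjoint (diff_op b) (diff_op_adj b)"
  unfolding diff_op_def diff_op_adj_def
  using U_adjoint[of "[]" 0 0] U_adjoint[of "inverse_word (gen b)" 0 0]
  by (intro is_adjoint_diff) (simp_all add: red_inverse inverse_inverse)

lemma alg_1_unit:
  assumes "A \<in> alg 1"
  shows "U 0 0 [] (A x) = A x" "A (U 0 0 [] x) = A x"
    "i \<noteq> 0 \<Longrightarrow> U j i [] (A x) = 0" "i \<noteq> 0 \<Longrightarrow> A (U i j [] x) = 0"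
proof -
  show 1: "U 0 0 [] (A x) = A x" for x using one_mat_compose(1)[OF assms] unfolding one_mat_1 by (rule compose_eqD)
  show 2: "A (U 0 0 [] x) = A x" for x using one_mat_compose(2)[OF assms] unfolding one_mat_1 by (rule compose_eqD)
  show "U j i [] (A x) = 0" if "i \<noteq> 0" using that unit_unit[of j i 0 0 "A x"] by (simp add: 1)
  show "A (U i j [] x) = 0" if "i \<noteq> 0" using that 2[of "U i j [] x"] by (simp add: blinfun.zero_right)
qed

lemma avg_diff_op [simp]: "avg 0 b (diff_op b x) = 0"
proof -
  have "inverse_word (gen b) = pow b (ord b - 1)"
    using ord_ge[of b] inverse_pow[of 1 b] by (simp add: gen_eq_pow)
  then have "avg 0 b o\<^sub>L U 0 0 (inverse_word (gen b)) = avg 0 b"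
    using avg_pow[of "ord b - 1" b 0] ord_pos[of b] by simp
  from compose_eqD[OF this, of x] show ?thesis
    by (simp add: diff_op_def blinfun_linear)
qed

definition D :: l2op where "D = diff_op False + (U 1 0 [] o\<^sub>L diff_op True)"
definition D_adj :: l2op where "D_adj = diff_op_adj False + (diff_op_adj True o\<^sub>L U 0 1 [])"

lemma D_in_alg: "D \<in> alg 2" "D_adj \<in> alg 2"
  unfolding D_def D_adj_def using diff_op_in_alg alg_mono[of 1 2]
  by (auto intro!: alg_add alg_compose U_in_alg)

lemma D_adjoint: "is_adjoint D D_adj"
  unfolding D_def D_adj_def using U_adjoint[of "[]" 1 0]
  by (intro is_adjoint_add is_adjoint_compose diff_op_adjoint) simp

text \<open>The cochain relation \<open>d1 d0 = 0\<close>, expressed through the averages.\<close>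

lemma avg_D [simp]: "avg 0 False (D x) = 0" "avg 1 True (D x) = 0"
proof -
  show "avg 0 False (D x) = 0" by (simp add: D_def blinfun_linear)
  \<comment> \<open>With \<open>avg_diff_op\<close> switched off both sides reach the normal form
    with the average outermost; otherwise the right side would collapse first.\<close>
  have "avg 1 True (U 1 0 [] (diff_op True x)) = U 1 0 [] (avg 0 True (diff_op True x))"
    by (simp del: avg_diff_op)
  also have "\<dots> = 0" by (simp only: avg_diff_op blinfun.zero_right)
  finally have 1: "avg 1 True (U 1 0 [] (diff_op True x)) = 0" .
  have "avg 1 True (diff_op False x) = avg 1 True (U 0 0 [] (diff_op False x))"
    by (simp only: alg_1_unit[OF diff_op_in_alg(1)])
  then have "avg 1 True (diff_op False x) = 0" by simp
  with 1 show "avg 1 True (D x) = 0" by (simp add: D_def blinfun_linear)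
qed

definition L :: l2op where
  "L = (diff_op_adj False o\<^sub>L diff_op False) + (diff_op_adj True o\<^sub>L diff_op True)"

lemma L_in_alg: "L \<in> alg 1"
  unfolding L_def by (intro alg_add alg_compose diff_op_in_alg)

lemma L_adjoint: "is_adjoint L L"
  unfolding L_def by (intro is_adjoint_add is_adjoint_compose diff_op_adjoint is_adjoint_sym[OF diff_op_adjoint])

lemma D_adj_D [simp]: "D_adj (D x) = L x"
  by (simp add: D_def D_adj_def L_def blinfun_linear alg_1_unit diff_op_in_alg)

lemma L_coercive: "1 / (132 * real (m + n)) * (norm (U 0 0 [] x))\<^sup>2 \<le> inner (L x) x"
proof -
  have "inner (L x) x = (norm (diff_op False x))\<^sup>2 + (norm (diff_op True x))\<^sup>2"
    by (simp add: L_def blinfun_linear inner_add_left is_adjointD'[OF diff_op_adjoint] power2_norm_eq_inner)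
  then show ?thesis using spectral_gap[of x] m_ge by (simp add: field_simps)
qed

lemma inverse_sqrt_L:
  obtains Z where "Z \<in> alg 1" "is_adjoint Z Z" "\<And>x. Z (L (Z x)) = U 0 0 [] x" "\<And>x. L (Z (Z x)) = U 0 0 [] x"
proof -
  interpret closed_operator_algebra "alg 1" "U 0 0 []"
    using one_mat_compose[of _ 1] one_mat_adjoint[of 1]
    by unfold_locales (auto simp: one_mat_1 subspace_alg closed_alg intro: alg_compose U_in_alg)
  have "0 < 1 / (132 * real (m + n))" using m_ge by simp
  from inverse_sqrt_exists[OF L_in_alg L_adjoint this L_coercive] obtain Z where
    Z: "Z \<in> alg 1" "is_adjoint Z Z" "Z o\<^sub>L (L o\<^sub>L Z) = U 0 0 []" "L o\<^sub>L (Z o\<^sub>L Z) = U 0 0 []" by blast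
  show thesis
    using that[OF Z(1,2)] compose_eqD[OF Z(3)] compose_eqD[OF Z(4)] by simp
qed

definition Z :: l2op where
  "Z = (SOME Z. Z \<in> alg 1 \<and> is_adjoint Z Z \<and> (\<forall>x. Z (L (Z x)) = U 0 0 [] x) \<and> (\<forall>x. L (Z (Z x)) = U 0 0 [] x))"

lemma Z: "Z \<in> alg 1" "is_adjoint Z Z" "Z (L (Z x)) = U 0 0 [] x" "L (Z (Z x)) = U 0 0 [] x"
proof -
  have "\<exists>Z. Z \<in> alg 1 \<and> is_adjoint Z Z \<and> (\<forall>x. Z (L (Z x)) = U 0 0 [] x) \<and> (\<forall>x. L (Z (Z x)) = U 0 0 [] x)"
    using inverse_sqrt_L by metis
  from someI_ex[OF this, folded Z_def] show "Z \<in> alg 1" "is_adjoint Z Z" "Z (L (Z x)) = U 0 0 [] x" "L (Z (Z x)) = U 0 0 [] x"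
    by auto
qed

section \<open>The isometric part of the polar decomposition of \<open>d0\<close>\<close>

definition V :: l2op where "V = D o\<^sub>L Z"
definition V_adj :: l2op where "V_adj = Z o\<^sub>L D_adj"

lemma V_in_alg: "V \<in> alg 2" "V_adj \<in> alg 2"
  unfolding V_def V_adj_def using D_in_alg Z(1) alg_mono[of 1 2] by (auto intro!: alg_compose)

lemma V_adjoint: "is_adjoint V V_adj"
  unfolding V_def V_adj_def by (intro is_adjoint_compose D_adjoint Z)

lemma V_adj_V [simp]: "V_adj (V x) = U 0 0 [] x"
  by (simp add: V_def V_adj_def Z)

text \<open>From \<open>L Z Z = 1\<close>. This says that \<open>V V_adj\<close> fixes the range of
  \<open>D\<close>, so its range is exactly that of \<open>d0\<close>.\<close>

lemma D_adj_V_V_adj [simp]: "D_adj (V (V_adj x)) = D_adj x"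
proof -
  have "U 0 0 [] (D_adj x) = D_adj x"
    by (simp add: D_adj_def blinfun_linear alg_1_unit diff_op_in_alg)
  then show ?thesis by (simp add: V_def V_adj_def Z)
qed

lemma avg_V [simp]: "avg 0 False (V x) = 0" "avg 1 True (V x) = 0"
  by (simp_all add: V_def)

lemma adjoint_annihilates:
  assumes "is_adjoint A A'" "is_adjoint B B'" "\<And>x. A (B x) = 0"
  shows "B' (A' x) = 0"
proof -
  have "A o\<^sub>L B = 0" by (rule blinfun_eqI) (simp add: assms(3))
  then have "B' o\<^sub>L A' = 0"
    using is_adjoint_compose[OF assms(1,2)] is_adjoint_zero is_adjoint_unique by metis
  then show ?thesis using compose_eqD[of B' A' 0 x] by simp
qed

lemma V_adj_avg [simp]: "V_adj (avg 0 False x) = 0" "V_adj (avg 1 True x) = 0"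
  by (rule adjoint_annihilates[OF avg_adjoint V_adjoint]; simp)+

lemma D_adj_avg [simp]: "D_adj (avg 0 False x) = 0" "D_adj (avg 1 True x) = 0"
  by (rule adjoint_annihilates[OF avg_adjoint D_adjoint]; simp)+

lemma alg_2_unit:
  assumes "A \<in> alg 2"
  shows "U 0 0 [] (A x) + U 1 1 [] (A x) = A x" "A (U 0 0 [] x) + A (U 1 1 [] x) = A x"
    "i \<ge> 2 \<Longrightarrow> U j i [] (A x) = 0" "i \<ge> 2 \<Longrightarrow> A (U i j [] x) = 0"
proof -
  show 1: "U 0 0 [] (A x) + U 1 1 [] (A x) = A x" for x
    using compose_eqD[OF one_mat_compose(1)[OF assms]] unfolding one_mat_2 by (simp add: blinfun_linear)
  show 2: "A (U 0 0 [] x) + A (U 1 1 [] x) = A x" for x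
    using compose_eqD[OF one_mat_compose(2)[OF assms]] unfolding one_mat_2 by (simp add: blinfun_linear)
  show "U j i [] (A x) = 0" if "i \<ge> 2"
    using that by (subst 1[symmetric]) (simp add: blinfun_linear)
  show "A (U i j [] x) = 0" if "i \<ge> 2"
    using that by (subst 2[symmetric]) (simp add: blinfun_linear)
qed

lemma V_unit [simp]: "V (U 0 0 [] x) = V x" "U 0 0 [] (V_adj x) = V_adj x"
  by (simp_all add: V_def V_adj_def alg_1_unit Z)

section \<open>The complementary projection in the two by two matrices\<close>

definition P1 :: l2op where
  "P1 = one_mat 2 - avg 0 False - avg 1 True - (V o\<^sub>L V_adj)"

lemma P1_apply: "P1 x = U 0 0 [] x + U 1 1 [] x - avg 0 False x - avg 1 True x - V (V_adj x)"
  by (simp add: P1_def one_mat_2 blinfun_linear)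

lemma P1_in_alg: "P1 \<in> alg 2"
  unfolding P1_def by (intro alg_diff one_mat_in_alg alg_compose V_in_alg avg_in_alg) auto

lemma P1_adjoint: "is_adjoint P1 P1"
  unfolding P1_def
  by (intro is_adjoint_diff one_mat_adjoint avg_adjoint is_adjoint_compose V_adjoint is_adjoint_sym[OF V_adjoint])

text \<open>The three projections subtracted in \<open>P1\<close> are mutually orthogonal. One side
  of the relations for the averages and \<open>V\<close> is computed, the other obtained by
  adjoints; the last relation is \<open>D_adj_V_V_adj\<close>.\<close>

lemma P1_annihilates [simp]:
  "P1 (avg 0 False x) = 0" "P1 (avg 1 True x) = 0" "P1 (V x) = 0"
  "avg 0 False (P1 x) = 0" "avg 1 True (P1 x) = 0" "V_adj (P1 x) = 0" "D_adj (P1 x) = 0"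
proof -
  show a: "P1 (avg 0 False x) = 0" "P1 (avg 1 True x) = 0" for x
    by (simp_all add: P1_apply blinfun_linear)
  show v: "P1 (V x) = 0" for x
    using alg_2_unit(1)[OF V_in_alg(1), of x] by (simp add: P1_apply blinfun_linear)
  show "avg 0 False (P1 x) = 0" "avg 1 True (P1 x) = 0"
    by (rule adjoint_annihilates[OF P1_adjoint avg_adjoint a(1)] adjoint_annihilates[OF P1_adjoint avg_adjoint a(2)])+
  show "V_adj (P1 x) = 0" by (rule adjoint_annihilates[OF P1_adjoint V_adjoint v])
  show "D_adj (P1 x) = 0"
    using alg_2_unit(2)[OF D_in_alg(2), of x] by (simp add: P1_apply blinfun_linear)
qed

lemma P1_idem [simp]: "P1 (P1 x) = P1 x"
proof -
  have "P1 (P1 x) = U 0 0 [] (P1 x) + U 1 1 [] (P1 x)"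
    by (subst P1_apply) (simp add: blinfun.zero_right)
  then show ?thesis by (simp only: alg_2_unit(1)[OF P1_in_alg])
qed

section \<open>The class of the projection\<close>

definition M :: l2op where "M = real m *\<^sub>R avg 0 False + real n *\<^sub>R avg 1 True"

text \<open>Identifies \<open>M\<close> with \<open>d1\<close>; in terms of averages its
  self-adjointness and kernel become visible.\<close>

lemma M_eq: "M = (\<Sum>i<m. U 0 0 (spow i)) + (\<Sum>j<n. U 1 1 (tpow j))"
proof -
  have "pow False = spow" "pow True = tpow" by (auto simp: pow_def spow_def tpow_def)
  then show ?thesis using m_ge n_ge by (simp add: M_def avg_def ord_of_def)
qed

lemma M_in_alg: "M \<in> alg 2"
  unfolding M_def by (intro alg_add alg_scaleR avg_in_alg) auto

lemma M_adjoint: "is_adjoint M M"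
  unfolding M_def by (intro is_adjoint_add is_adjoint_scaleR avg_adjoint)

lemma red_spow: "i < m \<Longrightarrow> red (spow i)" and red_tpow: "j < n \<Longrightarrow> red (tpow j)"
  by (auto simp: spow_def tpow_def red_Cons ord_of_def)

lemma d0_Rep: "d0 m n (Rep_ell2 x) = Rep_ell2 (D x)"
proof -
  have g: "spow 1 = gen False" "tpow 1 = gen True" by (auto simp: spow_def tpow_def gen_def)
  have "U 1 0 [] o\<^sub>L U 0 0 (inverse_word (gen True)) = U 1 0 (inverse_word (gen True))"
    by (subst U_compose) (simp_all add: red_inverse)
  then have "D = U 0 0 [] - U 0 0 (inverse_word (gen False)) + (U 1 0 [] - U 1 0 (inverse_word (gen True)))"
    by (simp add: D_def diff_op_def blinfun_compose_linear U_compose)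
  then show ?thesis
    by (simp add: d0_def g fun_eq_iff blinfun_linear plus_ell2.rep_eq minus_ell2.rep_eq Rep_U red_inverse)
qed

lemma d1_Rep: "d1 m n (Rep_ell2 x) = Rep_ell2 (M x)"
  by (simp add: d1_def M_eq fun_eq_iff blinfun_linear blinfun.sum_left plus_ell2.rep_eq Rep_sum Rep_U
      red_spow red_tpow)

lemma D_adj_comps: "D_adj x \<in> comps 1"
proof -
  have "U 0 0 [] (D_adj x) = D_adj x"
    by (simp add: D_adj_def blinfun_linear alg_1_unit diff_op_in_alg)
  then show ?thesis by (simp add: comps_def one_mat_1)
qed

lemma laplace1_Rep:
  assumes "x \<in> comps 2"
  shows "laplace1 m n (Rep_ell2 x) = Rep_ell2 (D (D_adj x) + M (M x))"
proof -
  have "adj m n 1 2 (d0 m n) (Rep_ell2 x) = Rep_ell2 (D_adj x)"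
    by (rule adj_eq[OF d0_Rep D_adjoint D_in_alg(2) assms D_adj_comps])
  moreover have "adj m n 2 2 (d1 m n) (Rep_ell2 (M x)) = Rep_ell2 (M (M x))"
    by (rule adj_eq[OF d1_Rep M_adjoint M_in_alg]) (auto intro: alg_in_comps M_in_alg)
  ultimately show ?thesis
    by (simp add: laplace1_def d0_Rep d1_Rep plus_ell2.rep_eq)
qed

definition harmonic :: "(nat \<times> word) ell2 set" where
  "harmonic = {x \<in> comps 2. D_adj x = 0 \<and> avg 0 False x = 0 \<and> avg 1 True x = 0}"

text \<open>Pairing with \<open>x\<close> gives a sum of two squared norms, so both
  \<open>D_adj x\<close> and \<open>M x\<close> vanish.\<close>

lemma laplace1_eq_0_iff:
  "D (D_adj x) + M (M x) = 0 \<longleftrightarrow> D_adj x = 0 \<and> avg 0 False x = 0 \<and> avg 1 True x = 0"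
proof
  assume 0: "D (D_adj x) + M (M x) = 0"
  have "(norm (D_adj x))\<^sup>2 + (norm (M x))\<^sup>2 = inner (D (D_adj x) + M (M x)) x"
    by (simp add: inner_add_left is_adjointD[OF D_adjoint] is_adjointD[OF M_adjoint] power2_norm_eq_inner)
  then have DM: "D_adj x = 0" "M x = 0" using 0 by (simp_all add: add_nonneg_eq_0_iff)
  \<comment> \<open>The averages in different components annihilate each other, so each can be
    isolated from \<open>M x\<close>.\<close>
  have "real m *\<^sub>R avg 0 False x = avg 0 False (M x)" "real n *\<^sub>R avg 1 True x = avg 1 True (M x)"
    by (simp_all add: M_def blinfun_linear)
  then show "D_adj x = 0 \<and> avg 0 False x = 0 \<and> avg 1 True x = 0"
    using DM m_ge n_ge by (simp add: blinfun_linear)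
qed (simp add: M_def blinfun_linear)

lemma ker_laplace1: "{f \<in> l2space m n 2. laplace1 m n f = (\<lambda>_. 0)} = Rep_ell2 ` harmonic"
proof -
  have "Rep_ell2 y = (\<lambda>_. 0) \<longleftrightarrow> y = 0" for y :: "(nat \<times> word) ell2"
    unfolding zero_ell2.rep_eq[symmetric] by (rule Rep_ell2_inject)
  then have *: "laplace1 m n (Rep_ell2 x) = (\<lambda>_. 0) \<longleftrightarrow> x \<in> harmonic" if "x \<in> comps 2" for x
    using that laplace1_eq_0_iff[of x] by (simp add: laplace1_Rep harmonic_def)
  show ?thesis
  proof (intro equalityI subsetI)
    fix f assume "f \<in> {f \<in> l2space m n 2. laplace1 m n f = (\<lambda>_. 0)}"
    then show "f \<in> Rep_ell2 ` harmonic" using * by (auto elim!: l2spaceE)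
  next
    fix f assume "f \<in> Rep_ell2 ` harmonic"
    then obtain x where "f = Rep_ell2 x" "x \<in> harmonic" "x \<in> comps 2" by (auto simp: harmonic_def)
    then show "f \<in> {f \<in> l2space m n 2. laplace1 m n f = (\<lambda>_. 0)}"
      using * by (simp add: Rep_in_l2space)
  qed
qed

text \<open>\<open>P1\<close> is self-adjoint, maps into the harmonic vectors and fixes each of
  them, which characterises the orthogonal projection.\<close>

lemma p1_realizes: "realizes 2 (p1 m n) P1"
  unfolding realizes_def
proof (intro conjI ballI)
  fix x assume x: "x \<in> comps 2"
  show "p1 m n (Rep_ell2 x) = Rep_ell2 (P1 x)"
    unfolding p1_def ker_laplace1
  proof (rule orthproj_eq[OF refl _ _ x])
    show "harmonic \<subseteq> comps 2" by (auto simp: harmonic_def)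
    show "x - y \<in> harmonic" if "x \<in> harmonic" "y \<in> harmonic" for x y
      using that by (auto simp: harmonic_def blinfun_linear intro: comps_diff)
    show "P1 x \<in> harmonic" by (simp add: harmonic_def alg_in_comps P1_in_alg)
    fix z assume z: "z \<in> harmonic"
    then have "U 0 0 [] z + U 1 1 [] z = z"
      by (simp add: harmonic_def comps_def one_mat_2 blinfun_linear)
    \<comment> \<open>Every subtracted term vanishes on \<open>z\<close>; for the last one,
      \<open>V_adj\<close> factors through \<open>D_adj\<close>.\<close>
    then have "P1 z = z" using z by (simp add: P1_apply harmonic_def V_adj_def blinfun_linear)
    then have "cinner x z = cinner (P1 x) z" by (simp add: cinner_adjoint[OF P1_adjoint P1_in_alg])
    then show "cinner (x - P1 x) z = 0"
      by (simp add: cinner_eq_inner inner_diff_left complex_eq_iff)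
  qed
qed (rule P1_in_alg)

section \<open>The block diagonal projections to be compared\<close>

lemma avg_s_realizes: "realizes 1 (avg_s m n) (avg 0 False)"
proof -
  have "pow False = spow" by (auto simp: pow_def spow_def)
  then have "avg_s m n (Rep_ell2 x) = Rep_ell2 (avg 0 False x)" for x
    by (simp add: avg_s_def avg_def ord_of_def fun_eq_iff blinfun_linear blinfun.sum_left
        scaleR_ell2.rep_eq Rep_sum Rep_U red_spow sum_distrib_left)
  then show ?thesis by (simp add: realizes_def avg_in_alg)
qed

lemma avg_t_realizes: "realizes 1 (avg_t m n) (avg 0 True)"
proof -
  have "pow True = tpow" by (auto simp: pow_def tpow_def)
  then have "avg_t m n (Rep_ell2 x) = Rep_ell2 (avg 0 True x)" for x
    by (simp add: avg_t_def avg_def ord_of_def fun_eq_iff blinfun_linear blinfun.sum_left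
        scaleR_ell2.rep_eq Rep_sum Rep_U red_tpow sum_distrib_left)
  then show ?thesis by (simp add: realizes_def avg_in_alg)
qed

lemma id_realizes: "realizes 1 (\<lambda>f. f) (U 0 0 [])"
  by (auto simp: realizes_def U_in_alg comps_def one_mat_1)

lemma shift_single: "shift_up o' 1 = U o' 0 []" "shift_down o' 1 = U 0 o' []"
  by (simp_all add: shift_up_def shift_down_def One_nat_def)

lemma shift_two: "shift_up 0 2 = one_mat 2" "shift_down 0 2 = one_mat 2"
  by (simp_all add: shift_up_def shift_down_def one_mat_def)

text \<open>The size is \<open>5 = 2 + 1 + 1 + 1\<close>; the last summand is the extra unit that
  will be matched with \<open>V V_adj\<close>.\<close>

lemma bdiag_source_realizes:
  "realizes 5 (bdiag [(2, p1 m n), (1, avg_s m n), (1, avg_t m n), (1, \<lambda>f. f)])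
    (P1 + avg 2 False + avg 3 True + U 4 4 [])" (is "realizes 5 ?T ?A")
  unfolding realizes_def
proof (intro conjI ballI)
  show "?A \<in> alg 5"
    using alg_mono[of 2 5] P1_in_alg by (auto intro!: alg_add avg_in_alg U_in_alg)
  fix x assume x: "x \<in> comps 5"
  have "one_mat 2 (P1 (one_mat 2 x)) = P1 x"
    using one_mat_compose[OF P1_in_alg] by (simp add: compose_eqD)
  moreover have "U 2 0 [] (avg 0 False (U 0 2 [] x)) = avg 2 False x"
    "U 3 0 [] (avg 0 True (U 0 3 [] x)) = avg 3 True x" by simp_all
  ultimately show "?T (Rep_ell2 x) = Rep_ell2 (?A x)"
    by (simp add: bdiag_def fun_eq_iff block_realizes[OF p1_realizes x] block_realizes[OF avg_s_realizes x]
        block_realizes[OF avg_t_realizes x] block_realizes[OF id_realizes x]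
        shift_single shift_two blinfun_linear plus_ell2.rep_eq del: add_2_eq_Suc add_2_eq_Suc')
qed

lemma bdiag_target_realizes:
  "realizes 5 (bdiag [(1, \<lambda>f. f), (1, \<lambda>f. f)]) (one_mat 2)" (is "realizes 5 ?T ?A")
  unfolding realizes_def
proof (intro conjI ballI)
  show "?A \<in> alg 5" using alg_mono[of 2 5] one_mat_in_alg by auto
  fix x assume x: "x \<in> comps 5"
  show "?T (Rep_ell2 x) = Rep_ell2 (?A x)"
    by (simp add: bdiag_def fun_eq_iff block_realizes[OF id_realizes x] one_mat_2
        shift_single blinfun_linear plus_ell2.rep_eq)
qed

text \<open>The four summands carry the summands of the block diagonal projection onto the four
  mutually orthogonal projections that make up the unit of the algebra of two by two matrices.\<close>

definition W :: l2op where
  "W = P1 + (avg 0 False o\<^sub>L U 0 2 []) + (avg 1 True o\<^sub>L U 1 3 []) + (V o\<^sub>L U 0 4 [])"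

definition W_adj :: l2op where
  "W_adj = P1 + (U 2 0 [] o\<^sub>L avg 0 False) + (U 3 1 [] o\<^sub>L avg 1 True) + (U 4 0 [] o\<^sub>L V_adj)"

lemma W_in_alg: "W \<in> alg 5" "W_adj \<in> alg 5"
  unfolding W_def W_adj_def using alg_mono[of 2 5] P1_in_alg V_in_alg
  by (auto intro!: alg_add alg_compose avg_in_alg U_in_alg)

lemma W_adjoint: "is_adjoint W W_adj"
  unfolding W_def W_adj_def
  using U_adjoint[of "[]" 0 2] U_adjoint[of "[]" 1 3] U_adjoint[of "[]" 0 4]
  by (intro is_adjoint_add is_adjoint_compose P1_adjoint avg_adjoint V_adjoint) simp_all

text \<open>The ranges of the four summands of \<open>W\<close> are orthogonal, so each summand of
  \<open>W_adj\<close> detects only its own partner.\<close>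

lemma W_adj_W: "W_adj (W x) = (P1 + avg 2 False + avg 3 True + U 4 4 []) x"
proof -
  have "avg 0 False (W x) = avg 0 False (U 0 2 [] x)" "avg 1 True (W x) = avg 1 True (U 1 3 [] x)"
    "P1 (W x) = P1 x" "V_adj (W x) = U 0 4 [] x"
    by (simp_all add: W_def blinfun_linear del: unit_avg_apply)
  then show ?thesis by (simp add: W_adj_def blinfun_linear)
qed

text \<open>The four source components are disjoint, so no cross terms survive, and the four range
  projections add up to the unit by the definition of \<open>P1\<close>.\<close>

lemma W_W_adj: "W (W_adj x) = one_mat 2 x"
proof -
  have V_adj_0: "U a i [] (V_adj x) = 0" if "i \<noteq> 0" for a i
    using unit_unit[of a i 0 0 "V_adj x"] that by simp
  have "P1 (W_adj x) = P1 x"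
    using alg_2_unit(4)[OF P1_in_alg]
    by (simp add: W_adj_def blinfun_linear del: unit_avg_apply)
  moreover have "U 0 2 [] (W_adj x) = avg 0 False x"
    "U 1 3 [] (W_adj x) = avg 1 True x" "U 0 4 [] (W_adj x) = V_adj x"
    using alg_2_unit(3)[OF P1_in_alg]
    by (simp_all add: W_adj_def blinfun_linear V_adj_0)
  ultimately show ?thesis by (simp add: W_def blinfun_linear P1_apply one_mat_2)
qed

lemma mvn_source_target:
  "mvn m n 5 (bdiag [(2, p1 m n), (1, avg_s m n), (1, avg_t m n), (1, \<lambda>f. f)])
    (bdiag [(1, \<lambda>f. f), (1, \<lambda>f. f)])"
  by (rule mvn_realizes[OF bdiag_source_realizes bdiag_target_realizes W_in_alg W_adjoint W_adj_W W_W_adj])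

lemma cstar_proj_p1: "cstar_proj m n 2 (p1 m n)"
  by (rule cstar_proj_realizes[OF p1_realizes P1_adjoint P1_idem])

lemma k0_eq_p1: "k0_eq m n [(2, p1 m n), (1, avg_s m n), (1, avg_t m n)] [(1, \<lambda>f. f)]"
proof -
  have proj: "cstar_proj m n 1 (avg_s m n)" "cstar_proj m n 1 (avg_t m n)" "cstar_proj m n 1 (\<lambda>f. f)"
    using cstar_proj_realizes[OF avg_s_realizes avg_adjoint avg_idem_apply]
      cstar_proj_realizes[OF avg_t_realizes avg_adjoint avg_idem_apply]
      cstar_proj_realizes[OF id_realizes] one_mat_adjoint[of 1] by (auto simp: one_mat_1)
  \<comment> \<open>Stabilising by \<open>r = 1\<close> supplies the unit equivalent to
    \<open>V V_adj\<close>: the relation proved is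
    \<open>[p1] + [P_s] + [P_t] + [1] = [1] + [1]\<close>.\<close>
  have "total_size [(2, p1 m n), (1, avg_s m n), (1, avg_t m n)] + 1 \<le> 5"
    "total_size [(1, \<lambda>f. f)] + 1 \<le> 5"
    by (simp_all add: total_size_def)
  moreover have "mvn m n 5 (bdiag ([(2, p1 m n), (1, avg_s m n), (1, avg_t m n)] @ [(1, \<lambda>f. f)]))
      (bdiag ([(1, \<lambda>f. f)] @ [(1, \<lambda>f. f)]))"
    using mvn_source_target by simp
  ultimately have "\<exists>r N. total_size [(2, p1 m n), (1, avg_s m n), (1, avg_t m n)] + r \<le> N \<and>
      total_size [(1, \<lambda>f. f)] + r \<le> N \<and>
      mvn m n N (bdiag ([(2, p1 m n), (1, avg_s m n), (1, avg_t m n)] @ [(r, \<lambda>f. f)]))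
        (bdiag ([(1, \<lambda>f. f)] @ [(r, \<lambda>f. f)]))"
    by blast
  with proj show ?thesis unfolding k0_eq_def using cstar_proj_p1 by simp
qed

end

theorem theorem4p3:
  fixes m n :: nat
  assumes "m \<ge> 2" and "n \<ge> 3"
  shows "cstar_proj m n 2 (p1 m n) \<and>
         k0_eq m n [(2, p1 m n), (1, avg_s m n), (1, avg_t m n)] [(1, \<lambda>f. f)]"
proof -
  interpret cyclic_free_product m n by unfold_locales (use assms in auto)
  show ?thesis using cstar_proj_p1 k0_eq_p1 by blast
qed

end
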